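(* Let $\{c(\beta):\beta\in\mathbb{Q}/\mathbb{Z}\}$ be real numbers such that $\beta\mapsto c(\beta)h(\beta)$ is bounded on $\mathbb{Q}/\mathbb{Z}$. For each irrational $\alpha\in\mathbb{R}/\mathbb{Z}$ and each positive integer $Q$, let $M=M(\alpha,Q)$ and $N=N(\alpha,Q)$ be the unique positive integers with $$1\le M\le a_N \quad\text{and}\quad Mq_{N-1}+q_{N-2}\le Q<(M+1)q_{N-1}+q_{N-2}.$$ Put $$S_Q(\alpha)=\sum_{n=1}^N(-1)^{n-1}q_{n-1}(\alpha)\sum_{\beta\in E_n(\alpha),\,h(\beta)\le Q}c(\beta).$$ Define three sets of irrational points $\alpha\in\mathbb{R}/\mathbb{Z}$: - $\mathcal{C}$ is the set where $\lim_{Q\to\infty}S_Q(\alpha)$ exists and is finite; - $\mathcal{D}$ is the set where $\liminf_{Q\to\infty}S_Q(\alpha)=-\infty$ and $\limsup_{Q\to\infty}S_Q(\alpha)=+\infty$; - $\mathcal{E}$ is the set where $\sum_{n=1}^\infty q_{n-1}(\alpha)^2\sum_{\beta\in E_n(\alpha)}c(\beta)^2<\infty$. Then, with $|\cdot|$ denoting Haar measure on $\mathbb{R}/\mathbb{Z}$: (i) $|\mathcal{C}\cup\mathcal{D}|=1$; (ii) $|\mathcal{C}\setminus\mathcal{E}|=0$; (iii) $|\mathcal{E}\setminus\mathcal{C}|=0$.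
   Context: Every $\beta\in\mathbb{Q}/\mathbb{Z}$ can be written $\beta=a/q$ with $q\ge1$ and $\gcd(a,q)=1$; its height is $h(\beta)=q$. Identify an irrational $\alpha\in\mathbb{R}/\mathbb{Z}$ with its representative in $(0,1)$ and write $\alpha=[0;a_1,a_2,\dots]$. Set $p_{-2}=0$, $q_{-2}=1$, $p_{-1}=1$, $q_{-1}=0$, and for $n\ge0$ set $p_n=a_np_{n-1}+p_{n-2}$ and $q_n=a_nq_{n-1}+q_{n-2}$, with $a_0=0$. For $n\ge1$, $$E_n(\alpha)=\left\{\frac{mp_{n-1}+p_{n-2}}{mq_{n-1}+q_{n-2}}:m=1,\dots,a_n\right\}\subset\mathbb{Q}/\mathbb{Z}.$$ *)

theory Defs
  imports "HOL-Analysis.Analysis"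
begin

definition eq_mod_one :: "rat \<Rightarrow> rat \<Rightarrow> bool" where
  "eq_mod_one x y \<longleftrightarrow> x - y \<in> \<int>"

quotient_type rat_circle = rat / eq_mod_one
  morphisms rep_circle to_circle
proof (rule equivpI)
  show "reflp eq_mod_one" by (auto simp: reflp_def eq_mod_one_def)
  show "symp eq_mod_one"
    unfolding symp_def eq_mod_one_def by (metis Ints_minus minus_diff_eq)
  show "transp eq_mod_one"
    unfolding transp_def eq_mod_one_def by (metis Ints_add diff_add_cancel add_diff_eq)
qed

lemma denominator_eq_mod_one:
  assumes "eq_mod_one x y"
  shows "snd (quotient_of x) = snd (quotient_of y)"
proof -
  obtain k where k: "x = y + of_int k"
    using assms by (auto simp: eq_mod_one_def Ints_def algebra_simps)
  obtain a b where ab: "quotient_of y = (a, b)" by (cases "quotient_of y")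
  have b: "b > 0" and cop: "coprime a b"
    using ab quotient_of_denom_pos quotient_of_coprime by blast+
  have "y = of_int a / of_int b" using ab by (rule quotient_of_div)
  then have "x = of_int (a + k * b) / of_int b" using k b by (simp add: field_simps)
  then have "x = Fract (a + k * b) b" by (simp add: Fract_of_int_quotient)
  moreover have "coprime (a + k * b) b"
    using cop by (metis coprime_commute coprime_iff_gcd_eq_1 gcd_add_mult add.commute)
  ultimately have "quotient_of x = (a + k * b, b)"
    using b by (simp add: quotient_of_Fract normalize_stable)
  then show ?thesis using ab by simp
qed

lift_definition height :: "rat_circle \<Rightarrow> nat" is "\<lambda>x. nat (snd (quotient_of x))"
  by (simp add: denominator_eq_mod_one)

text \<open>Irrational points of \<open>\<real>/\<int>\<close>, identified with their representatives in \<open>(0, 1)\<close>.\<close>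

definition irrational_points :: "real set" where
  "irrational_points = {0<..<1} - \<rat>"

text \<open>Regular continued fractions: \<open>cf_tail \<alpha> n\<close> is the \<open>n\<close>-th complete quotient,
  so that \<open>\<alpha> = [a\<^sub>0; a\<^sub>1, \<dots>, a\<^bsub>n-1\<^esub>, cf_tail \<alpha> n]\<close>. For irrational
  \<open>\<alpha> \<in> (0, 1)\<close> no division by zero occurs, \<open>a\<^sub>0 = 0\<close>, and the truncation \<open>nat\<close> is harmless.\<close>

primrec cf_tail :: "real \<Rightarrow> nat \<Rightarrow> real" where
  "cf_tail \<alpha> 0 = \<alpha>"
| "cf_tail \<alpha> (Suc n) = 1 / frac (cf_tail \<alpha> n)"

definition cf_digit :: "real \<Rightarrow> nat \<Rightarrow> nat" where
  "cf_digit \<alpha> n = nat \<lfloor>cf_tail \<alpha> n\<rfloor>"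

text \<open>The index is shifted by two, to accommodate \<open>p\<^bsub>-2\<^esub>\<close> and \<open>q\<^bsub>-2\<^esub>\<close>:
  \<open>cf_p \<alpha> k = p\<^bsub>k-2\<^esub>\<close> and \<open>cf_q \<alpha> k = q\<^bsub>k-2\<^esub>\<close>. In particular
  \<open>cf_q \<alpha> (n + 1) = q\<^bsub>n-1\<^esub>\<close> and \<open>cf_q \<alpha> n = q\<^bsub>n-2\<^esub>\<close>.\<close>

fun cf_p :: "real \<Rightarrow> nat \<Rightarrow> nat" where
  "cf_p \<alpha> 0 = 0"
| "cf_p \<alpha> (Suc 0) = 1"
| "cf_p \<alpha> (Suc (Suc n)) = cf_digit \<alpha> n * cf_p \<alpha> (Suc n) + cf_p \<alpha> n"

fun cf_q :: "real \<Rightarrow> nat \<Rightarrow> nat" where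
  "cf_q \<alpha> 0 = 1"
| "cf_q \<alpha> (Suc 0) = 0"
| "cf_q \<alpha> (Suc (Suc n)) = cf_digit \<alpha> n * cf_q \<alpha> (Suc n) + cf_q \<alpha> n"

definition cf_E :: "real \<Rightarrow> nat \<Rightarrow> rat_circle set" where
  "cf_E \<alpha> n =
     (\<lambda>m. to_circle (of_nat (m * cf_p \<alpha> (n + 1) + cf_p \<alpha> n) /
                     of_nat (m * cf_q \<alpha> (n + 1) + cf_q \<alpha> n))) ` {1..cf_digit \<alpha> n}"

text \<open>The pair \<open>(M, N)\<close>; see \<open>cutoff_unique\<close> below for existence and uniqueness.\<close>

definition cutoff :: "real \<Rightarrow> nat \<Rightarrow> nat \<times> nat" where
  "cutoff \<alpha> Q = (THE (M, N). 1 \<le> N \<and> 1 \<le> M \<and> M \<le> cf_digit \<alpha> N \<and>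
     M * cf_q \<alpha> (N + 1) + cf_q \<alpha> N \<le> Q \<and> Q < (M + 1) * cf_q \<alpha> (N + 1) + cf_q \<alpha> N)"

lemma cf_tail_irrational: "\<alpha> \<notin> \<rat> \<Longrightarrow> cf_tail \<alpha> n \<notin> \<rat>"
proof (induction n)
  case (Suc n)
  show ?case
  proof
    assume "cf_tail \<alpha> (Suc n) \<in> \<rat>"
    then have "inverse (1 / frac (cf_tail \<alpha> n)) \<in> \<rat>"
      using Rats_inverse by (metis cf_tail.simps(2))
    then have "frac (cf_tail \<alpha> n) \<in> \<rat>" by simp
    then have "frac (cf_tail \<alpha> n) + of_int \<lfloor>cf_tail \<alpha> n\<rfloor> \<in> \<rat>" by (intro Rats_add) auto
    then show False using Suc by (simp add: frac_def)
  qed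
qed simp

lemma cf_digit_pos:
  assumes "\<alpha> \<notin> \<rat>" "n \<ge> 1"
  shows "cf_digit \<alpha> n \<ge> 1"
proof -
  obtain k where n: "n = Suc k" using assms(2) by (cases n) auto
  have "cf_tail \<alpha> k \<notin> \<int>"
    using cf_tail_irrational[OF assms(1)] Ints_subset_Rats by blast
  then have "frac (cf_tail \<alpha> k) > 0" by (simp add: frac_gt_0_iff)
  moreover have "frac (cf_tail \<alpha> k) < 1" by (rule frac_lt_1)
  ultimately have "cf_tail \<alpha> n \<ge> 1" by (simp add: n)
  then show ?thesis by (simp add: cf_digit_def le_nat_iff le_floor_iff)
qed

lemma cf_q_pos:
  assumes "\<alpha> \<in> irrational_points"
  shows "cf_q \<alpha> (n + 2) \<ge> 1"
proof -
  have irr: "\<alpha> \<notin> \<rat>" using assms by (simp add: irrational_points_def)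
  show ?thesis
  proof (induction n)
    case (Suc n)
    have "cf_digit \<alpha> (Suc n) * cf_q \<alpha> (n + 2) \<ge> 1"
      using cf_digit_pos[OF irr, of "Suc n"] Suc by (simp del: cf_q.simps)
    moreover have "cf_q \<alpha> (Suc n + 2) = cf_digit \<alpha> (Suc n) * cf_q \<alpha> (n + 2) + cf_q \<alpha> (n + 1)"
      by (simp add: numeral_2_eq_2)
    ultimately show ?case by linarith
  qed (simp add: numeral_2_eq_2)
qed

lemma cutoff_unique:
  assumes "\<alpha> \<in> irrational_points" "Q \<ge> 1"
  shows "\<exists>!(M, N). 1 \<le> N \<and> 1 \<le> M \<and> M \<le> cf_digit \<alpha> N \<and>
     M * cf_q \<alpha> (N + 1) + cf_q \<alpha> N \<le> Q \<and> Q < (M + 1) * cf_q \<alpha> (N + 1) + cf_q \<alpha> N"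
    (is "\<exists>!(M, N). ?P M N")
proof -
  define g where "g k = cf_q \<alpha> (k + 2) + cf_q \<alpha> (k + 1)" for k
  have irr: "\<alpha> \<notin> \<rat>" using assms by (simp add: irrational_points_def)
  have q: "cf_q \<alpha> (k + 2) \<ge> 1" for k using cf_q_pos[OF assms(1)] .
  have rec: "cf_q \<alpha> (k + 3) = cf_digit \<alpha> (Suc k) * cf_q \<alpha> (k + 2) + cf_q \<alpha> (k + 1)" for k
    by (simp add: numeral_3_eq_3 numeral_2_eq_2)
  have g_Suc: "g (Suc k) = (cf_digit \<alpha> (Suc k) + 1) * cf_q \<alpha> (k + 2) + cf_q \<alpha> (k + 1)" for k
    using rec[of k] by (simp add: g_def eval_nat_numeral)
  have g0: "g 0 = 1" by (simp add: g_def numeral_2_eq_2)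
  have "g k < g (Suc k)" for k
    using mult_le_mono1[OF cf_digit_pos[OF irr, of "Suc k"], of "cf_q \<alpha> (k + 2)"] q[of k]
    unfolding g_Suc unfolding g_def by (simp del: cf_q.simps)
  then have mono: "strict_mono g" by (simp add: strict_mono_Suc_iff)
  have in_block: "g k \<le> Q \<and> Q < g (Suc k)" if P: "?P M (Suc k)" for M k
  proof -
    have "1 * cf_q \<alpha> (k + 2) \<le> M * cf_q \<alpha> (k + 2)"
      and "(M + 1) * cf_q \<alpha> (k + 2) \<le> (cf_digit \<alpha> (Suc k) + 1) * cf_q \<alpha> (k + 2)"
      using P by (auto intro!: mult_le_mono1)
    moreover have "M * cf_q \<alpha> (k + 2) + cf_q \<alpha> (k + 1) \<le> Q"
      "Q < (M + 1) * cf_q \<alpha> (k + 2) + cf_q \<alpha> (k + 1)"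
      using P by (simp_all del: cf_q.simps)
    ultimately show ?thesis unfolding g_Suc unfolding g_def by linarith
  qed
  have uniq_M: "M = M'" if "?P M N" "?P M' N" for M M' N
  proof -
    have "M * cf_q \<alpha> (N + 1) < (M' + 1) * cf_q \<alpha> (N + 1)"
      "M' * cf_q \<alpha> (N + 1) < (M + 1) * cf_q \<alpha> (N + 1)" using that by linarith+
    then have "M < M' + 1" "M' < M + 1" by (meson mult_less_cancel2)+
    then show ?thesis by linarith
  qed
  have uniq_N: "k = k'" if P: "?P M (Suc k)" "?P M' (Suc k')" for M M' k k'
  proof -
    have "g k < g (Suc k')" "g k' < g (Suc k)" using in_block[OF P(1)] in_block[OF P(2)] by auto
    then have "k < Suc k'" "k' < Suc k" using mono by (simp_all add: strict_mono_less)
    then show ?thesis by linarith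
  qed
  have "\<exists>k. g k \<le> Q \<and> Q < g (Suc k)"
  proof -
    define k where "k = (LEAST k. Q < g (Suc k))"
    have "Suc Q \<le> g (Suc Q)" using mono by (rule strict_mono_imp_increasing)
    then have "Q < g (Suc Q)" by simp
    then have k: "Q < g (Suc k)" unfolding k_def by (rule LeastI)
    have "g k \<le> Q"
    proof (cases k)
      case 0
      then show ?thesis using g0 assms(2) by simp
    next
      case (Suc j)
      then have "\<not> Q < g (Suc j)" using not_less_Least[of j "\<lambda>k. Q < g (Suc k)"] k_def by simp
      then show ?thesis using Suc by simp
    qed
    with k show ?thesis by blast
  qed
  then obtain k where k: "g k \<le> Q" "Q < g (Suc k)" by blast
  define b where "b = cf_q \<alpha> (k + 2)"
  define r where "r = cf_q \<alpha> (k + 1)"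
  define M where "M = (Q - r) div b"
  have b: "b \<ge> 1" using q b_def by simp
  have kb: "b + r \<le> Q" "Q < (cf_digit \<alpha> (Suc k) + 1) * b + r"
    using k unfolding g_Suc unfolding g_def b_def r_def by auto
  have M1: "1 \<le> M" unfolding M_def using kb(1) b by (simp add: div_greater_zero_iff Suc_le_eq)
  have M2: "M \<le> cf_digit \<alpha> (Suc k)"
  proof -
    have "Q - r < (cf_digit \<alpha> (Suc k) + 1) * b" using kb by linarith
    then have "M < cf_digit \<alpha> (Suc k) + 1" unfolding M_def by (rule less_mult_imp_div_less)
    then show ?thesis by simp
  qed
  have "M * b \<le> Q - r" unfolding M_def by simp
  then have M3: "M * b + r \<le> Q" using kb(1) by linarith
  have "Q - r < (M + 1) * b" unfolding M_def using b dividend_less_div_times[of b "Q - r"] by simp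
  then have M4: "Q < (M + 1) * b + r" by linarith
  have ex: "?P M (Suc k)" using M1 M2 M3 M4 unfolding b_def r_def by (simp del: cf_q.simps)
  show ?thesis
  proof (rule ex1I[of _ "(M, Suc k)"])
    show "case (M, Suc k) of (M, N) \<Rightarrow> ?P M N" using ex by simp
  next
    fix x assume "case x of (M, N) \<Rightarrow> ?P M N"
    then obtain M' N where x: "x = (M', N)" and P: "?P M' N" by (cases x) auto
    obtain k' where N: "N = Suc k'" using P by (cases N) auto
    have "k' = k" using uniq_N P ex unfolding N by blast
    then have "?P M' (Suc k)" using P N by blast
    then have "M' = M" using uniq_M ex by blast
    then show "x = (M, Suc k)" using \<open>k' = k\<close> N x by blast
  qed
qed

definition cutoff_N :: "real \<Rightarrow> nat \<Rightarrow> nat" where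
  "cutoff_N \<alpha> Q = snd (cutoff \<alpha> Q)"

definition S :: "(rat_circle \<Rightarrow> real) \<Rightarrow> nat \<Rightarrow> real \<Rightarrow> real" where
  "S c Q \<alpha> = (\<Sum>n = 1..cutoff_N \<alpha> Q. (-1) ^ (n - 1) * real (cf_q \<alpha> (n + 1)) *
                (\<Sum>\<beta> \<in> {\<beta> \<in> cf_E \<alpha> n. height \<beta> \<le> Q}. c \<beta>))"

text \<open>Points of \<open>\<real>/\<int>\<close> are identified with their representatives in \<open>[0, 1)\<close>; Haar measure
  then becomes Lebesgue measure on \<open>[0, 1)\<close>.\<close>

definition haar_circle :: "real measure" where
  "haar_circle = lebesgue_on {0..<1}"

definition set_C :: "(rat_circle \<Rightarrow> real) \<Rightarrow> real set" where
  "set_C c = {\<alpha> \<in> irrational_points. convergent (\<lambda>Q. S c Q \<alpha>)}"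

definition set_D :: "(rat_circle \<Rightarrow> real) \<Rightarrow> real set" where
  "set_D c = {\<alpha> \<in> irrational_points.
     liminf (\<lambda>Q. ereal (S c Q \<alpha>)) = -\<infinity> \<and> limsup (\<lambda>Q. ereal (S c Q \<alpha>)) = \<infinity>}"

text \<open>The series starts at \<open>n = 1\<close>, so its \<open>n\<close>-th term is taken at \<open>n + 1\<close>.\<close>

definition set_E :: "(rat_circle \<Rightarrow> real) \<Rightarrow> real set" where
  "set_E c = {\<alpha> \<in> irrational_points.
     summable (\<lambda>n. (real (cf_q \<alpha> (n + 2)))\<^sup>2 * (\<Sum>\<beta> \<in> cf_E \<alpha> (n + 1). (c \<beta>)\<^sup>2))}"

end

theory Submission
  imports Defs "HOL-Probability.Probability_Measure"
begin

text \<open>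
  Passing from Farey order \<open>Q - 1\<close> to \<open>Q\<close> splits the Farey intervals
  \<open>(a/b, a'/b')\<close> with \<open>b + b' = Q\<close> at their mediant \<open>\<beta>\<close>, and
  \<open>S\<^bsub>Q\<^esub> - S\<^bsub>Q-1\<^esub>\<close> equals \<open>b c(\<beta>)\<close> on the left piece and
  \<open>-b' c(\<beta>)\<close> on the right one. The pieces have lengths \<open>1/(b(b + b'))\<close> and
  \<open>1/(b'(b + b'))\<close>, so \<open>S\<^bsub>Q\<^esub>\<close> is a martingale for the Farey partitions. Its
  increments are bounded because \<open>c(\<beta>) h(\<beta>)\<close> is, and the sum of their squares is the
  series defining \<open>\<E>\<close>. The theorem is thus an instance of the classical facts on martingales
  with bounded increments, each obtained by stopping: boundedness on one side implies boundedness,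
  boundedness implies a finite square function, which in turn implies convergence.
\<close>

subsection \<open>Martingales with bounded increments over finite partitions\<close>

text \<open>Outside \<open>set_D\<close> the partial sums are bounded on one side, so the whole
  chain applies and gives (i). A convergent sequence is bounded, so the middle link gives (ii); the
  last link is (iii). Bounded increments matter because a process stopped on crossing a threshold
  overshoots it by at most the bound \<open>K\<close>; countably many integer thresholds then
  exhaust the event in question. Functions of the k-th partition take finitely many values, so
  orthogonality to them can replace conditional expectation, and integrability comes for free. The
  obstacle is that \<open>S\<close> is defined through the continued fraction of each single point,
  whereas the partitions depend on Q alone. The link: for the cutoff (M, N), the Farey interval
  around \<alpha> has p_{N-1}/q_{N-1} as an endpoint, and every split at a fraction of E_N keeps it.
  This endpoint supplies the weight q_{N-1}, and the sign records on which side of \<alpha> it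
  lies.\<close>

text \<open>A finite partition of the space is given by a labelling \<open>atom k\<close> of its points.\<close>

locale finite_filtration = prob_space M for M :: "'a measure" +
  fixes atom :: "nat \<Rightarrow> 'a \<Rightarrow> 'b"
  assumes simple_atom: "simple_function M (atom k)"
    and atom_refine: "\<lbrakk>x \<in> space M; y \<in> space M; atom (Suc k) x = atom (Suc k) y\<rbrakk>
                       \<Longrightarrow> atom k x = atom k y"
begin

section \<open>Functions constant on the atoms of a partition\<close>

definition adapted :: "nat \<Rightarrow> ('a \<Rightarrow> 'c) \<Rightarrow> bool" where
  "adapted k Z \<longleftrightarrow> (\<forall>x\<in>space M. \<forall>y\<in>space M. atom k x = atom k y \<longrightarrow> Z x = Z y)"

lemma adaptedI:
  "(\<And>x y. \<lbrakk>x \<in> space M; y \<in> space M; atom k x = atom k y\<rbrakk> \<Longrightarrow> Z x = Z y) \<Longrightarrow> adapted k Z"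
  unfolding adapted_def by blast

lemma adaptedD:
  "\<lbrakk>adapted k Z; x \<in> space M; y \<in> space M; atom k x = atom k y\<rbrakk> \<Longrightarrow> Z x = Z y"
  unfolding adapted_def by blast

lemma adapted_mono: "\<lbrakk>adapted k Z; k \<le> l\<rbrakk> \<Longrightarrow> adapted l Z"
proof (induction l)
  case (Suc l)
  then show ?case
    unfolding adapted_def by (metis atom_refine le_Suc_eq)
qed simp

text \<open>An adapted function factors through \<open>atom k\<close>, which has finitely many
  values. Later measurability and integrability obligations reduce to this.\<close>

lemma adapted_simple:
  assumes "adapted k Z"
  shows "simple_function M Z"
proof -
  define g where "g a = Z (SOME x. x \<in> space M \<and> atom k x = a)" for a
  have "Z x = g (atom k x)" if "x \<in> space M" for x
  proof -
    have "(SOME y. y \<in> space M \<and> atom k y = atom k x) \<in> space M \<and>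
          atom k (SOME y. y \<in> space M \<and> atom k y = atom k x) = atom k x"
      using that by (intro someI_ex[of "\<lambda>y. y \<in> space M \<and> atom k y = atom k x"]) auto
    then show ?thesis unfolding g_def using adaptedD[OF assms that] by auto
  qed
  moreover have "simple_function M (g \<circ> atom k)"
    using simple_atom by (rule simple_function_compose)
  ultimately show ?thesis
    by (subst simple_function_cong[of M Z "g \<circ> atom k"]) auto
qed

lemma adapted_sets:
  assumes "adapted k P"
  shows "{x\<in>space M. P x} \<in> sets M"
proof -
  have "P -` {True} \<inter> space M \<in> sets M"
    using adapted_simple[OF assms] by (rule simple_functionD)
  then show ?thesis by (simp add: vimage_def Int_def conj_commute)
qed

lemma adapted_integrable:
  fixes Z :: "'a \<Rightarrow> real"
  assumes "adapted k Z"
  shows "integrable M Z"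
  using adapted_simple[OF assms]
  by (intro integrable_simple_function) (auto simp: emeasure_eq_measure)

lemma adapted_comb:
  assumes "adapted k Y" "adapted k Z"
  shows "adapted k (\<lambda>x. f (Y x) (Z x))"
  using assms unfolding adapted_def by metis

lemma adapted_comp: "adapted k Z \<Longrightarrow> adapted k (\<lambda>x. f (Z x))"
  unfolding adapted_def by metis

section \<open>Martingale differences and stopping\<close>

definition psum :: "(nat \<Rightarrow> 'a \<Rightarrow> real) \<Rightarrow> nat \<Rightarrow> 'a \<Rightarrow> real" where
  "psum d n x = (\<Sum>j<n. d j x)"

text \<open>The last clause says that the conditional expectation of \<open>d k\<close> given the
  k-th partition vanishes, expressed by testing against all adapted functions.\<close>

definition martingale_diff :: "real \<Rightarrow> (nat \<Rightarrow> 'a \<Rightarrow> real) \<Rightarrow> bool" where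
  "martingale_diff K d \<longleftrightarrow>
     (\<forall>k. adapted (Suc k) (d k)) \<and> (\<forall>k. \<forall>x\<in>space M. \<bar>d k x\<bar> \<le> K) \<and>
     (\<forall>k Z. adapted k Z \<longrightarrow> (\<integral>x. Z x * d k x \<partial>M) = 0)"

text \<open>The stopping time is the first i at which \<open>R i\<close> fails, and increments from
  that index on are dropped. The test includes \<open>R k\<close> itself: it is decided by the k-th
  partition, whereas \<open>d k\<close> is only known one step later.\<close>

definition stopped :: "(nat \<Rightarrow> 'a \<Rightarrow> bool) \<Rightarrow> (nat \<Rightarrow> 'a \<Rightarrow> real) \<Rightarrow> nat \<Rightarrow> 'a \<Rightarrow> real" where
  "stopped R d k x = (if \<forall>i\<le>k. R i x then d k x else 0)"

lemma psum_0 [simp]: "psum d 0 x = 0" and psum_Suc [simp]: "psum d (Suc n) x = psum d n x + d n x"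
  by (simp_all add: psum_def)

lemma adapted_psum:
  assumes "martingale_diff K d"
  shows "adapted k (psum d k)"
proof (rule adaptedI)
  fix x y assume xy: "x \<in> space M" "y \<in> space M" "atom k x = atom k y"
  have "d j x = d j y" if "j < k" for j
    using assms that xy adapted_mono[of "Suc j" "d j" k]
    by (intro adaptedD[of k "d j"]) (auto simp: martingale_diff_def)
  then show "psum d k x = psum d k y" by (simp add: psum_def)
qed

lemma adapted_all:
  assumes "\<And>i. adapted i (R i)"
  shows "adapted k (\<lambda>x. \<forall>i\<le>k. R i x)"
  using adapted_mono[OF assms] unfolding adapted_def by blast

lemma adapted_ex:
  assumes "\<And>i. adapted i (R i)"
  shows "adapted k (\<lambda>x. \<exists>i\<le>k. R i x)"
  using adapted_mono[OF assms] unfolding adapted_def by blast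

text \<open>An adapted function is a finite linear combination of indicators of atoms, so
  orthogonality need only be tested on single atoms.\<close>

lemma martingale_diffI:
  assumes a: "\<And>k. adapted (Suc k) (d k)" and b: "\<And>k x. x \<in> space M \<Longrightarrow> \<bar>d k x\<bar> \<le> K"
    and c: "\<And>k x. x \<in> space M \<Longrightarrow>
              (\<integral>y. d k y * indicator {y\<in>space M. atom k y = atom k x} y \<partial>M) = 0"
  shows "martingale_diff K d"
  unfolding martingale_diff_def
proof (intro conjI allI impI ballI a b)
  fix k :: nat and Z :: "'a \<Rightarrow> real" assume Z: "adapted k Z"
  define F where "F = atom k ` space M"
  have fin: "finite F" unfolding F_def using simple_atom by (rule simple_functionD)
  define A where "A s = {y\<in>space M. atom k y = s}" for s
  have A: "A s \<in> sets M" for s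
    unfolding A_def by (intro adapted_sets[of k] adaptedI) simp
  define g where "g s = Z (SOME x. x \<in> A s)" for s
  have zg: "Z y = g (atom k y)" if "y \<in> space M" for y
  proof -
    have "y \<in> A (atom k y)" using that by (simp add: A_def)
    then have "(SOME x. x \<in> A (atom k y)) \<in> A (atom k y)" by (rule someI)
    then show ?thesis unfolding g_def using adaptedD[OF Z that] by (simp add: A_def)
  qed
  have dI: "integrable M (\<lambda>y. d k y * indicator (A s) y)" for s
    using A adapted_integrable[OF a] by (intro integrable_real_mult_indicator)
  have "(\<integral>y. Z y * d k y \<partial>M) = (\<integral>y. (\<Sum>s\<in>F. g s * (d k y * indicator (A s) y)) \<partial>M)"
  proof (intro Bochner_Integration.integral_cong refl)
    fix y assume y: "y \<in> space M"
    have "(\<Sum>s\<in>F. g s * (d k y * indicator (A s) y)) = (\<Sum>s\<in>{atom k y}. g s * (d k y * indicator (A s) y))"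
      using y fin by (intro sum.mono_neutral_right) (auto simp: F_def A_def)
    also have "\<dots> = Z y * d k y" using y by (simp add: zg A_def)
    finally show "Z y * d k y = (\<Sum>s\<in>F. g s * (d k y * indicator (A s) y))" ..
  qed
  also have "\<dots> = (\<Sum>s\<in>F. g s * (\<integral>y. d k y * indicator (A s) y \<partial>M))"
    using dI by (subst Bochner_Integration.integral_sum) (auto intro!: integrable_mult_right)
  also have "\<dots> = 0"
    using c[of _ k] by (intro sum.neutral) (auto simp: F_def A_def)
  finally show "(\<integral>y. Z y * d k y \<partial>M) = 0" .
qed

text \<open>\<open>P k\<close> is decided before \<open>d k\<close>, so the selection can be moved
  from the increment to the test function.\<close>

lemma martingale_diff_transform:
  assumes "martingale_diff K d" "\<And>k. adapted k (P k)"
  shows "martingale_diff K (\<lambda>k x. if P k x then d k x else 0)"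
  unfolding martingale_diff_def
proof (intro conjI allI ballI impI)
  fix k
  have "adapted (Suc k) (P k)" "adapted (Suc k) (d k)"
    using assms adapted_mono[OF assms(2), of k "Suc k"] by (auto simp: martingale_diff_def)
  then show "adapted (Suc k) (\<lambda>x. if P k x then d k x else 0)"
    by (rule adapted_comb)
next
  fix k x assume "x \<in> space M"
  then have "\<bar>d k x\<bar> \<le> K" using assms(1) by (auto simp: martingale_diff_def)
  then show "\<bar>if P k x then d k x else 0\<bar> \<le> K" by auto
next
  fix k :: nat and Z :: "'a \<Rightarrow> real" assume Z: "adapted k Z"
  have "adapted k (\<lambda>x. if P k x then Z x else 0)"
    using assms(2) Z by (rule adapted_comb)
  then have "(\<integral>x. (if P k x then Z x else 0) * d k x \<partial>M) = 0"
    using assms(1) by (auto simp: martingale_diff_def)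
  then show "(\<integral>x. Z x * (if P k x then d k x else 0) \<partial>M) = 0"
    by (simp add: if_distrib if_distribR cong: if_cong)
qed

lemma martingale_diff_stopped:
  assumes "martingale_diff K d" "\<And>k. adapted k (R k)"
  shows "martingale_diff K (stopped R d)"
proof -
  have "stopped R d = (\<lambda>k x. if \<forall>i\<le>k. R i x then d k x else 0)"
    by (intro ext) (simp add: stopped_def)
  then show ?thesis
    using martingale_diff_transform[OF assms(1), OF adapted_all[OF assms(2)]] by simp
qed

lemma psum_stopped_before:
  "(\<And>i. i < n \<Longrightarrow> R i x) \<Longrightarrow> psum (stopped R d) n x = psum d n x"
  unfolding psum_def stopped_def by (intro sum.cong) auto

lemma psum_stopped_after:
  "\<lbrakk>\<not> R k x; k \<le> n\<rbrakk> \<Longrightarrow> psum (stopped R d) n x = psum (stopped R d) k x"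
  by (induction n) (auto simp: le_Suc_eq stopped_def)

text \<open>The k of the second case is the first failure of \<open>R\<close>, that is, the stopping
  time.\<close>

lemma psum_stopped_cases:
  obtains "\<And>i. i < n \<Longrightarrow> R i x" "psum (stopped R d) n x = psum d n x"
  | k where "k < n" "\<And>i. i < k \<Longrightarrow> R i x" "\<not> R k x" "psum (stopped R d) n x = psum d k x"
proof (cases "\<forall>i<n. R i x")
  case True
  then show ?thesis using that(1) psum_stopped_before by blast
next
  case False
  define k where "k = (LEAST i. \<not> R i x)"
  have k: "\<not> R k x" unfolding k_def using False LeastI_ex[of "\<lambda>i. \<not> R i x"] by blast
  have b: "R i x" if "i < k" for i using not_less_Least that unfolding k_def by blast
  have "k < n"
  proof -
    obtain i where "i < n" "\<not> R i x" using False by blast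
    then show ?thesis unfolding k_def using Least_le[of "\<lambda>i. \<not> R i x" i] by linarith
  qed
  moreover have "psum (stopped R d) n x = psum d k x"
    using psum_stopped_after[of R, OF k, of n d] psum_stopped_before[of k R x d] b \<open>k < n\<close> by simp
  ultimately show ?thesis using that(2) k b by blast
qed

section \<open>Second moments and almost sure behaviour\<close>

lemma integrable_psum_square: "martingale_diff K d \<Longrightarrow> integrable M (\<lambda>x. (psum d n x)\<^sup>2)"
  by (rule adapted_integrable[OF adapted_comp[OF adapted_psum]])

lemma integrable_diff_square:
  assumes "martingale_diff K d"
  shows "integrable M (\<lambda>x. (d k x)\<^sup>2)"
proof -
  have "adapted (Suc k) (d k)" using assms unfolding martingale_diff_def by blast
  then show ?thesis by (rule adapted_integrable[OF adapted_comp])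
qed

text \<open>The increments are orthogonal: \<open>psum d n\<close> is adapted to the n-th partition,
  so the cross term with \<open>d n\<close> integrates to 0.\<close>

lemma expectation_psum_square:
  assumes "martingale_diff K d"
  shows "(\<integral>x. (psum d n x)\<^sup>2 \<partial>M) = (\<Sum>k<n. \<integral>x. (d k x)\<^sup>2 \<partial>M)"
proof (induction n)
  case (Suc n)
  have a: "adapted (Suc n) (psum d n)" "adapted (Suc n) (d n)"
    using assms adapted_mono[OF adapted_psum[OF assms], of n "Suc n"] by (auto simp: martingale_diff_def)
  have i: "integrable M (\<lambda>x. (psum d n x)\<^sup>2)" "integrable M (\<lambda>x. 2 * (psum d n x * d n x))"
    "integrable M (\<lambda>x. (d n x)\<^sup>2)"
    using integrable_psum_square[OF assms] integrable_diff_square[OF assms]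
      adapted_integrable[OF adapted_comb[OF a, of "\<lambda>u v. 2 * (u * v)"]] by simp_all
  have "(\<integral>x. psum d n x * d n x \<partial>M) = 0"
    using assms adapted_psum[OF assms] by (auto simp: martingale_diff_def)
  then have "(\<integral>x. 2 * (psum d n x * d n x) \<partial>M) = 0" by simp
  moreover have "(psum d (Suc n) x)\<^sup>2 = (psum d n x)\<^sup>2 + 2 * (psum d n x * d n x) + (d n x)\<^sup>2" for x
    by (simp add: power2_eq_square algebra_simps)
  ultimately show ?case using Suc i
    by (simp only: Bochner_Integration.integral_add Bochner_Integration.integrable_add sum.lessThan_Suc)
qed simp

lemma expectation_psum:
  assumes "martingale_diff K d"
  shows "(\<integral>x. psum d n x \<partial>M) = 0"
proof -
  have "(\<integral>x. d k x \<partial>M) = 0" for k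
  proof -
    have "adapted k (\<lambda>_. 1 :: real)" by (simp add: adapted_def)
    then have "(\<integral>x. 1 * d k x \<partial>M) = 0" using assms unfolding martingale_diff_def by blast
    then show ?thesis by simp
  qed
  moreover have "integrable M (d k)" for k
    using assms by (auto simp: martingale_diff_def intro: adapted_integrable)
  ultimately show ?thesis by (simp add: psum_def)
qed

lemma psum_bound:
  assumes "martingale_diff K d" "x \<in> space M"
  shows "\<bar>psum d (Suc k) x - psum d k x\<bar> \<le> K"
  using assms by (auto simp: martingale_diff_def)

text \<open>Stop when the partial sum first reaches size e. On the event the stopped sum at time n
  still has size at least e, and stopping can only decrease the second moment.\<close>

lemma kolmogorov_maximal_inequality:
  assumes d: "martingale_diff K d" and e: "e > 0"
  shows "e\<^sup>2 * prob {x\<in>space M. \<exists>k\<le>n. \<bar>psum d k x\<bar> \<ge> e} \<le> (\<Sum>k<n. \<integral>x. (d k x)\<^sup>2 \<partial>M)"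
proof -
  define R where "R i x \<longleftrightarrow> \<bar>psum d i x\<bar> < e" for i x
  have R: "adapted i (R i)" for i
    unfolding R_def by (intro adapted_comp[OF adapted_psum[OF d]])
  define A where "A = {x\<in>space M. \<exists>k\<le>n. \<bar>psum d k x\<bar> \<ge> e}"
  let ?d = "stopped R d"
  have d': "martingale_diff K ?d" using d R by (rule martingale_diff_stopped)
  have A: "A \<in> sets M" unfolding A_def
    by (intro adapted_sets[of n] adapted_ex adapted_comp[OF adapted_psum[OF d]])
  have "e\<^sup>2 * indicator A x \<le> (psum ?d n x)\<^sup>2" for x
  proof (cases "x \<in> A")
    case True
    then obtain k where k: "k \<le> n" "\<not> R k x" unfolding R_def A_def by auto
    have "\<bar>psum ?d n x\<bar> \<ge> e"
    proof (rule psum_stopped_cases[of n R x d])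
      assume "\<And>i. i < n \<Longrightarrow> R i x" "psum ?d n x = psum d n x"
      then show ?thesis using k R_def le_neq_implies_less by (metis not_less)
    next
      fix j assume "\<not> R j x" "psum ?d n x = psum d j x"
      then show ?thesis by (simp add: R_def)
    qed
    then show ?thesis using True e by (simp add: abs_le_square_iff[symmetric])
  qed simp
  then have "(\<integral>x. e\<^sup>2 * indicator A x \<partial>M) \<le> (\<integral>x. (psum ?d n x)\<^sup>2 \<partial>M)"
    by (intro integral_mono integrable_psum_square[OF d'] integrable_mult_right integrable_real_indicator A)
      (simp_all add: emeasure_eq_measure)
  also have "\<dots> = (\<Sum>k<n. \<integral>x. (?d k x)\<^sup>2 \<partial>M)" using d' by (rule expectation_psum_square)
  also have "\<dots> \<le> (\<Sum>k<n. \<integral>x. (d k x)\<^sup>2 \<partial>M)"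
    using integrable_diff_square[OF d] integrable_diff_square[OF d']
    by (intro sum_mono integral_mono) (auto simp: stopped_def)
  finally have "e\<^sup>2 * prob A \<le> (\<Sum>k<n. \<integral>x. (d k x)\<^sup>2 \<partial>M)" using A by simp
  then show ?thesis unfolding A_def .
qed

text \<open>The maximal inequality, applied to the increments from m on and extended to an infinite
  horizon by continuity from below, bounds the oscillation after m by a tail of the variance series.
  As m grows the tail vanishes, so the partial sums are almost surely Cauchy.\<close>

lemma AE_convergent_of_summable_expectation:
  assumes d: "martingale_diff K d" and sm: "summable (\<lambda>k. \<integral>x. (d k x)\<^sup>2 \<partial>M)"
  shows "AE x in M. convergent (\<lambda>n. psum d n x)"
proof -
  let ?v = "\<lambda>k. \<integral>x. (d k x)\<^sup>2 \<partial>M"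
  have Xs: "psum d k \<in> borel_measurable M" for k
    using adapted_simple[OF adapted_psum[OF d]] by (rule borel_measurable_simple_function)
  have bound: "e\<^sup>2 * prob {x\<in>space M. \<exists>k\<ge>m. \<bar>psum d k x - psum d m x\<bar> \<ge> e} \<le> (\<Sum>k. ?v (k + m))"
    if e: "e > 0" for e :: real and m
  proof -
    \<comment> \<open>Suppressing the first m increments gives a martingale difference whose partial
      sums are the differences \<open>psum d k x - psum d m x\<close>.\<close>
    define d' where "d' = (\<lambda>k x. if m \<le> k then d k x else 0)"
    have d': "martingale_diff K d'" unfolding d'_def
      by (intro martingale_diff_transform[OF d]) (simp add: adapted_def)
    have ps: "psum d' k x = (if m \<le> k then psum d k x - psum d m x else 0)" for k x
      by (induction k) (auto simp: d'_def not_less_eq_eq le_Suc_eq)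
    define A where "A n = {x\<in>space M. \<exists>k\<le>n. \<bar>psum d' k x\<bar> \<ge> e}" for n
    have A: "A n \<in> sets M" for n
      unfolding A_def by (intro adapted_sets[of n] adapted_ex adapted_comp[OF adapted_psum[OF d']])
    have incA: "incseq A" unfolding A_def incseq_def using order_trans by blast
    have "e\<^sup>2 * prob (A n) \<le> (\<Sum>k. ?v (k + m))" for n
    proof -
      have "e\<^sup>2 * prob (A n) \<le> (\<Sum>k<n. \<integral>x. (d' k x)\<^sup>2 \<partial>M)"
        unfolding A_def using d' e by (rule kolmogorov_maximal_inequality)
      \<comment> \<open>The range is lengthened by m so that exactly n terms remain once the m
        suppressed ones are removed.\<close>
      also have "\<dots> \<le> (\<Sum>k<n + m. \<integral>x. (d' k x)\<^sup>2 \<partial>M)" by (intro sum_mono2) auto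
      also have "\<dots> = (\<Sum>k\<in>{m..<n+m}. ?v k)"
        by (intro sum.mono_neutral_cong_right) (auto simp: d'_def)
      also have "\<dots> = (\<Sum>k<n. ?v (k + m))"
        using sum.shift_bounds_nat_ivl[of ?v 0 m n] by (simp add: atLeast0LessThan)
      also have "\<dots> \<le> (\<Sum>k. ?v (k + m))"
        by (intro sum_le_suminf summable_ignore_initial_segment[OF sm]) auto
      finally show ?thesis .
    qed
    moreover have "(\<lambda>n. prob (A n)) \<longlonglongrightarrow> prob (\<Union>n. A n)"
      using A incA by (intro finite_Lim_measure_incseq) auto
    ultimately have "e\<^sup>2 * prob (\<Union>n. A n) \<le> (\<Sum>k. ?v (k + m))"
      by (intro LIMSEQ_le_const2[OF tendsto_mult_left]) auto
    moreover have "(\<Union>n. A n) = {x\<in>space M. \<exists>k\<ge>m. \<bar>psum d k x - psum d m x\<bar> \<ge> e}"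
      using e by (force simp: A_def ps)
    ultimately show ?thesis by (simp only:)
  qed
  have tail: "(\<lambda>m. \<Sum>k. ?v (k + m)) \<longlonglongrightarrow> 0" using sm by (rule suminf_exist_split2)
  have "AE x in M. \<exists>m. \<forall>k\<ge>m. \<bar>psum d k x - psum d m x\<bar> < e" if e: "e > 0" for e :: real
  proof -
    define T where "T m = {x\<in>space M. \<exists>k\<ge>m. \<bar>psum d k x - psum d m x\<bar> \<ge> e}" for m
    define B where "B = (\<Inter>m. T m)"
    have T: "T m \<in> sets M" for m unfolding T_def using Xs by measurable
    have B: "B \<in> sets M" unfolding B_def using T by auto
    have "e\<^sup>2 * prob B \<le> (\<Sum>k. ?v (k + m))" for m
    proof -
      have "prob B \<le> prob (T m)"
        using T by (intro finite_measure_mono) (auto simp: B_def)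
      then have "e\<^sup>2 * prob B \<le> e\<^sup>2 * prob (T m)"
        by (intro mult_left_mono) auto
      with bound[OF e, of m] show ?thesis unfolding T_def by linarith
    qed
    then have "e\<^sup>2 * prob B \<le> 0" by (intro LIMSEQ_le_const[OF tail]) auto
    then have "prob B = 0" using e by (simp add: mult_le_0_iff measure_le_0_iff)
    then have "B \<in> null_sets M" using B by (simp add: emeasure_eq_measure null_sets_def)
    then have "AE x in M. x \<notin> B" by (rule AE_not_in)
    then show ?thesis using AE_space
      by eventually_elim (force simp: B_def T_def)
  qed
  then have "AE x in M. \<forall>i. \<exists>m. \<forall>k\<ge>m. \<bar>psum d k x - psum d m x\<bar> < 1 / real (Suc i)"
    by (subst AE_all_countable) auto
  then show ?thesis
  proof (eventually_elim)
    case (elim x)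
    have "Cauchy (\<lambda>n. psum d n x)"
    proof (rule metric_CauchyI)
      fix e :: real assume "e > 0"
      then obtain i where i: "1 / real (Suc i) < e / 2"
        using reals_Archimedean[of "e/2"] by (auto simp: inverse_eq_divide)
      obtain m where m: "\<forall>k\<ge>m. \<bar>psum d k x - psum d m x\<bar> < 1 / real (Suc i)" using elim by blast
      have "dist (psum d k x) (psum d l x) < e" if "k \<ge> m" "l \<ge> m" for k l
        using m[rule_format, OF that(1)] m[rule_format, OF that(2)] i unfolding dist_real_def by argo
      then show "\<exists>m. \<forall>k\<ge>m. \<forall>l\<ge>m. dist (psum d k x) (psum d l x) < e" by blast
    qed
    then show ?case by (simp add: Cauchy_convergent_iff)
  qed
qed

text \<open>Stop once the sum of squares exceeds an integer L. The stopped process has summable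
  second moments, hence converges; a point with summable squares is never stopped when L is
  large.\<close>

lemma AE_convergent_of_summable:
  assumes d: "martingale_diff K d"
  shows "AE x in M. summable (\<lambda>k. (d k x)\<^sup>2) \<longrightarrow> convergent (\<lambda>n. psum d n x)"
proof -
  define R where "R L i x \<longleftrightarrow> (\<Sum>j<i. (d j x)\<^sup>2) \<le> real L" for L i x
  have R: "adapted i (R L i)" for i L
  proof (rule adaptedI)
    fix x y assume xy: "x \<in> space M" "y \<in> space M" "atom i x = atom i y"
    have "d j x = d j y" if "j < i" for j
      using d that xy adapted_mono[of "Suc j" "d j" i]
      by (intro adaptedD[of i "d j"]) (auto simp: martingale_diff_def)
    then show "R L i x = R L i y" by (simp add: R_def)
  qed
  have "AE x in M. convergent (\<lambda>n. psum (stopped (R L) d) n x)" for L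
  proof (rule AE_convergent_of_summable_expectation)
    let ?d = "stopped (R L) d"
    show d': "martingale_diff K ?d" using d R by (rule martingale_diff_stopped)
    \<comment> \<open>The last increment before stopping can carry the sum of squares past L, but
      only by \<open>K\<^sup>2\<close>.\<close>
    have pt: "(\<Sum>k<n. (?d k x)\<^sup>2) \<le> real L + K\<^sup>2" if x: "x \<in> space M" for n x
    proof (induction n)
      case (Suc n)
      show ?case
      proof (cases "\<forall>i\<le>n. R L i x")
        case True
        have "(\<Sum>k<n. (?d k x)\<^sup>2) = (\<Sum>k<n. (d k x)\<^sup>2)"
          using True by (intro sum.cong) (auto simp: stopped_def)
        also have "\<dots> \<le> real L" using True by (simp add: R_def)
        moreover have "\<bar>?d n x\<bar> \<le> K" using d' x by (auto simp: martingale_diff_def)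
        then have "(?d n x)\<^sup>2 \<le> K\<^sup>2" using abs_le_square_iff[of "?d n x" K] by auto
        ultimately show ?thesis by simp
      next
        case False
        then have "?d n x = 0" by (auto simp: stopped_def)
        then show ?thesis using Suc by simp
      qed
    qed simp
    show "summable (\<lambda>k. \<integral>x. (?d k x)\<^sup>2 \<partial>M)"
    proof (rule summableI_nonneg_bounded[of _ "real L + K\<^sup>2"])
      fix n
      have i: "integrable M (\<lambda>x. (?d k x)\<^sup>2)" for k
        using integrable_diff_square[OF d'] .
      have "(\<Sum>k<n. \<integral>x. (?d k x)\<^sup>2 \<partial>M) = (\<integral>x. (\<Sum>k<n. (?d k x)\<^sup>2) \<partial>M)"
        using i by (simp add: Bochner_Integration.integral_sum)
      also have "\<dots> \<le> (\<integral>x. real L + K\<^sup>2 \<partial>M)"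
        using i pt by (intro integral_mono) auto
      finally show "(\<Sum>k<n. \<integral>x. (?d k x)\<^sup>2 \<partial>M) \<le> real L + K\<^sup>2" by (simp add: prob_space)
    qed auto
  qed
  then have "AE x in M. \<forall>L. convergent (\<lambda>n. psum (stopped (R L) d) n x)"
    by (subst AE_all_countable) auto
  then show ?thesis
  proof (eventually_elim, intro impI)
    fix x assume c: "\<forall>L. convergent (\<lambda>n. psum (stopped (R L) d) n x)"
      and s: "summable (\<lambda>k. (d k x)\<^sup>2)"
    obtain L :: nat where L: "(\<Sum>k. (d k x)\<^sup>2) \<le> real L" using real_arch_simple by blast
    have "R L i x" for i
      unfolding R_def using sum_le_suminf[OF s, of "{..<i}"] L by force
    then have "psum (stopped (R L) d) n x = psum d n x" for n by (intro psum_stopped_before)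
    then show "convergent (\<lambda>n. psum d n x)" using c[rule_format, of L] by simp
  qed
qed

text \<open>Stop when the absolute value exceeds an integer L. The stopped sums are bounded by
  \<open>L + K\<close>, so by orthogonality the expected sum of squares is at most
  \<open>(L + K)\<^sup>2\<close>; bounded paths are never stopped for large L.\<close>

lemma AE_summable_of_bounded:
  assumes d: "martingale_diff K d"
  shows "AE x in M. (\<exists>L. \<forall>n. \<bar>psum d n x\<bar> \<le> L) \<longrightarrow> summable (\<lambda>k. (d k x)\<^sup>2)"
proof -
  define R where "R L i x \<longleftrightarrow> \<bar>psum d i x\<bar> \<le> real L" for L i x
  have R: "adapted i (R L i)" for i L
    unfolding R_def by (intro adapted_comp[OF adapted_psum[OF d]])
  have K: "K \<ge> 0"
    using d not_empty unfolding martingale_diff_def by (meson abs_ge_zero ex_in_conv order_trans)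
  have "AE x in M. summable (\<lambda>k. (stopped (R L) d k x)\<^sup>2)" for L
  proof -
    let ?d = "stopped (R L) d"
    have d': "martingale_diff K ?d" using d R by (rule martingale_diff_stopped)
    have i: "integrable M (\<lambda>x. (?d k x)\<^sup>2)" for k
      using integrable_diff_square[OF d'] .
    have pt: "(psum ?d n x)\<^sup>2 \<le> (real L + K)\<^sup>2" if x: "x \<in> space M" for n x
    proof -
      have "\<bar>psum ?d n x\<bar> \<le> real L + K"
      proof (induction n)
        case (Suc n)
        show ?case
        proof (cases "\<forall>i\<le>n. R L i x")
          case True
          then have "psum ?d n x = psum d n x" by (intro psum_stopped_before) auto
          then have "\<bar>psum ?d n x\<bar> \<le> real L" using True by (simp add: R_def)
          then show ?thesis using psum_bound[OF d' x, of n] by linarith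
        next
          case False
          then have "?d n x = 0" by (auto simp: stopped_def)
          then show ?thesis using Suc by simp
        qed
      qed (use K in simp)
      then show ?thesis using K abs_le_square_iff[of "psum ?d n x" "real L + K"] by simp
    qed
    have le: "(\<Sum>k<n. \<integral>x. (?d k x)\<^sup>2 \<partial>M) \<le> (real L + K)\<^sup>2" for n
    proof -
      have "(\<Sum>k<n. \<integral>x. (?d k x)\<^sup>2 \<partial>M) = (\<integral>x. (psum ?d n x)\<^sup>2 \<partial>M)"
        using d' by (rule expectation_psum_square[symmetric])
      also have "\<dots> \<le> (\<integral>x. (real L + K)\<^sup>2 \<partial>M)"
        using integrable_psum_square[OF d'] pt by (intro integral_mono) auto
      finally show ?thesis by (simp add: prob_space)
    qed
    \<comment> \<open>Monotone convergence: the sum of squares has finite integral, hence is finite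
      almost everywhere.\<close>
    have "(\<integral>\<^sup>+x. (\<Sum>k. ennreal ((?d k x)\<^sup>2)) \<partial>M) = (\<Sum>k. \<integral>\<^sup>+x. ennreal ((?d k x)\<^sup>2) \<partial>M)"
      using i by (intro nn_integral_suminf) auto
    also have "\<dots> = (\<Sum>k. ennreal (\<integral>x. (?d k x)\<^sup>2 \<partial>M))"
      using i by (intro suminf_cong nn_integral_eq_integral) auto
    also have "\<dots> = ennreal (\<Sum>k. \<integral>x. (?d k x)\<^sup>2 \<partial>M)"
      using le by (intro suminf_ennreal2 summableI_nonneg_bounded[of _ "(real L + K)\<^sup>2"]) auto
    finally have "(\<integral>\<^sup>+x. (\<Sum>k. ennreal ((?d k x)\<^sup>2)) \<partial>M) \<noteq> \<infinity>" by simp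
    then have "AE x in M. (\<Sum>k. ennreal ((?d k x)\<^sup>2)) \<noteq> \<infinity>"
      using i by (intro nn_integral_PInf_AE) auto
    then show ?thesis
      by eventually_elim (auto intro: summable_suminf_not_top)
  qed
  then have "AE x in M. \<forall>L. summable (\<lambda>k. (stopped (R L) d k x)\<^sup>2)"
    by (subst AE_all_countable) auto
  then show ?thesis
  proof (eventually_elim, intro impI, elim exE)
    fix x l assume c: "\<forall>L. summable (\<lambda>k. (stopped (R L) d k x)\<^sup>2)"
      and s: "\<forall>n. \<bar>psum d n x\<bar> \<le> l"
    obtain L :: nat where L: "l \<le> real L" using real_arch_simple by blast
    have "R L i x" for i unfolding R_def using s L order_trans by blast
    then have "stopped (R L) d k x = d k x" for k by (simp add: stopped_def)
    then show "summable (\<lambda>k. (d k x)\<^sup>2)" using c[rule_format, of L] by simp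
  qed
qed

text \<open>Stop on leaving the interval from -l (excluded) to L (included). The stopped sum has
  mean 0 and is at most \<open>L + K\<close>, so it can be at most -l only with probability at most
  \<open>(L + K) / l\<close>. Letting l grow, paths bounded above by L but unbounded below form a
  null set.\<close>

lemma AE_bounded_below:
  assumes d: "martingale_diff K d"
  shows "AE x in M. (\<exists>L. \<forall>n. psum d n x \<le> L) \<longrightarrow> (\<exists>L. \<forall>n. psum d n x \<ge> L)"
proof -
  have Xs [measurable]: "psum d k \<in> borel_measurable M" for k
    using adapted_simple[OF adapted_psum[OF d]] by (rule borel_measurable_simple_function)
  have K: "K \<ge> 0"
    using d not_empty unfolding martingale_diff_def by (meson abs_ge_zero ex_in_conv order_trans)
  define U where "U L = {x\<in>space M. (\<forall>k. psum d k x \<le> real L) \<and> (\<forall>l::nat. \<exists>k. psum d k x \<le> - real l)}"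
    for L :: nat
  have "U L \<in> null_sets M" for L
  proof -
    have U: "U L \<in> sets M" unfolding U_def by measurable
    have bd: "real l * prob (U L) \<le> real L + K" for l :: nat
    proof -
      define R where "R i x \<longleftrightarrow> psum d i x \<le> real L \<and> psum d i x > - real l" for i x
      have R: "adapted i (R i)" for i
        unfolding R_def by (intro adapted_comp[OF adapted_psum[OF d]])
      let ?d = "stopped R d"
      have d': "martingale_diff K ?d" using d R by (rule martingale_diff_stopped)
      have up: "psum ?d n x \<le> real L + K" if x: "x \<in> space M" for n x
      proof (induction n)
        case (Suc n)
        show ?case
        proof (cases "\<forall>i\<le>n. R i x")
          case True
          then have "psum ?d n x = psum d n x" by (intro psum_stopped_before) auto
          then have "psum ?d n x \<le> real L" using True by (simp add: R_def)
          then show ?thesis using psum_bound[OF d' x, of n] by linarith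
        next
          case False
          then have "?d n x = 0" by (auto simp: stopped_def)
          then show ?thesis using Suc by simp
        qed
      qed (use K in simp)
      define A where "A n = {x\<in>space M. psum ?d n x \<le> - real l}" for n
      \<comment> \<open>The bound by L concerns all times, so \<open>V n\<close> is not an event of
        the n-th partition; it is therefore compared with \<open>A n\<close>, which is.\<close>
      define V where "V n = {x\<in>space M. (\<forall>k. psum d k x \<le> real L) \<and> (\<exists>k\<le>n. psum d k x \<le> - real l)}" for n
      have V: "V n \<in> sets M" for n unfolding V_def by measurable
      have incV: "incseq V" unfolding V_def incseq_def using order_trans by blast
      have A: "A n \<in> sets M" for n
        unfolding A_def by (intro adapted_sets[of n] adapted_comp[OF adapted_psum[OF d']])
      have VA: "V n \<subseteq> A n" for n
      proof
        fix x assume x: "x \<in> V n"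
        then obtain k where k: "k \<le> n" "\<not> R k x" unfolding R_def V_def by auto
        have "psum ?d n x \<le> - real l"
        proof (rule psum_stopped_cases[of n R x d])
          assume "\<And>i. i < n \<Longrightarrow> R i x" "psum ?d n x = psum d n x"
          then show ?thesis using k x unfolding R_def V_def
            by (metis (mono_tags, lifting) le_neq_implies_less mem_Collect_eq not_le)
        next
          fix j assume "\<not> R j x" "psum ?d n x = psum d j x"
          then show ?thesis using x by (auto simp: R_def V_def)
        qed
        then show "x \<in> A n" using x by (simp add: A_def V_def)
      qed
      have "real l * prob (V n) \<le> real L + K" for n
      proof -
        \<comment> \<open>On \<open>A n\<close> the left side is at most -l and \<open>L + K\<close>
          is nonnegative; elsewhere this is the bound \<open>up\<close>. Integrating against mean 0
          gives the estimate.\<close>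
        have "psum ?d n x \<le> (real L + K) - real l * indicator (A n) x" if "x \<in> space M" for x
          using up[OF that, of n] K that by (cases "x \<in> A n") (auto simp: A_def)
        then have "(\<integral>x. psum ?d n x \<partial>M) \<le> (\<integral>x. (real L + K) - real l * indicator (A n) x \<partial>M)"
          by (intro integral_mono adapted_integrable[OF adapted_psum[OF d']] integrable_const
              Bochner_Integration.integrable_diff integrable_mult_right integrable_real_indicator A)
             (simp_all add: emeasure_eq_measure)
        also have "\<dots> = real L + K - real l * prob (A n)"
          using A by (subst Bochner_Integration.integral_diff) (auto simp: prob_space emeasure_eq_measure)
        finally have "real l * prob (A n) \<le> real L + K" using expectation_psum[OF d', of n] by simp
        moreover have "real l * prob (V n) \<le> real l * prob (A n)"
          using VA[of n] A[of n] by (intro mult_left_mono finite_measure_mono) auto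
        ultimately show ?thesis by linarith
      qed
      moreover have "(\<lambda>n. prob (V n)) \<longlonglongrightarrow> prob (\<Union>n. V n)"
        using V incV by (intro finite_Lim_measure_incseq) auto
      ultimately have "real l * prob (\<Union>n. V n) \<le> real L + K"
        by (intro LIMSEQ_le_const2[OF tendsto_mult_left]) auto
      moreover have "prob (U L) \<le> prob (\<Union>n. V n)"
        using V unfolding U_def V_def by (intro finite_measure_mono) blast+
      then have "real l * prob (U L) \<le> real l * prob (\<Union>n. V n)" by (intro mult_left_mono) auto
      ultimately show ?thesis by linarith
    qed
    have "prob (U L) = 0"
    proof (rule ccontr)
      assume "prob (U L) \<noteq> 0"
      then have "prob (U L) > 0" by (simp add: zero_less_measure_iff)
      then obtain l :: nat where "real L + K < real l * prob (U L)"
        using reals_Archimedean3 by blast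
      then show False using bd[of l] by linarith
    qed
    then show ?thesis using U by (simp add: emeasure_eq_measure null_sets_def)
  qed
  then have "AE x in M. x \<notin> U L" for L by (rule AE_not_in)
  then have "AE x in M. \<forall>L. x \<notin> U L" by (subst AE_all_countable) auto
  then show ?thesis using AE_space
  proof (eventually_elim, intro impI, elim exE)
    fix x l assume x: "\<forall>L. x \<notin> U L" "x \<in> space M" and s: "\<forall>n. psum d n x \<le> l"
    obtain L :: nat where L: "l \<le> real L" using real_arch_simple by blast
    have "\<forall>k. psum d k x \<le> real L" using s L order_trans by blast
    then obtain m :: nat where "\<And>k. \<not> psum d k x \<le> - real m" using x unfolding U_def by blast
    then show "\<exists>L. \<forall>n. psum d n x \<ge> L" by (meson linear)
  qed
qed

lemma martingale_diff_uminus: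
  assumes "martingale_diff K d"
  shows "martingale_diff K (\<lambda>k x. - d k x)"
  unfolding martingale_diff_def
proof (intro conjI allI ballI impI)
  fix k
  have "adapted (Suc k) (d k)" using assms unfolding martingale_diff_def by blast
  then show "adapted (Suc k) (\<lambda>x. - d k x)" by (rule adapted_comp)
qed (use assms in \<open>auto simp: martingale_diff_def\<close>)

lemma AE_bounded_of_one_sided:
  assumes d: "martingale_diff K d"
  shows "AE x in M. (\<exists>L. \<forall>n. psum d n x \<le> L) \<or> (\<exists>L. \<forall>n. psum d n x \<ge> L) \<longrightarrow>
           (\<exists>L. \<forall>n. \<bar>psum d n x\<bar> \<le> L)"
proof -
  have m: "psum (\<lambda>k x. - d k x) n x = - psum d n x" for n x by (simp add: psum_def sum_negf)
  have "\<exists>L. \<forall>n. \<bar>psum d n x\<bar> \<le> L" if "\<forall>n. psum d n x \<le> a" "\<forall>n. psum d n x \<ge> b" for x a b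
  proof (intro exI[of _ "max a (-b)"] allI)
    fix n
    show "\<bar>psum d n x\<bar> \<le> max a (-b)"
      using that(1)[rule_format, of n] that(2)[rule_format, of n] by linarith
  qed
  note * = this
  show ?thesis
    using AE_bounded_below[OF d] AE_bounded_below[OF martingale_diff_uminus[OF d]]
  proof eventually_elim
    case (elim x)
    have "\<exists>L. \<forall>n. psum d n x \<le> L" if "\<forall>n. psum d n x \<ge> b" for b
    proof -
      have "\<forall>n. - psum d n x \<le> - b" using that by simp
      then obtain L where "\<forall>n. - psum d n x \<ge> L" using elim(2) unfolding m by blast
      then have "\<forall>n. psum d n x \<le> - L" by (simp add: le_minus_iff)
      then show ?thesis ..
    qed
    then show ?case using elim(1) * by blast
  qed
qed

end

subsection \<open>The Farey partitions\<close>

lemma space_haar_circle [simp]: "space haar_circle = {0..<1}"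
  by (simp add: haar_circle_def)

lemma sets_haar_circle_ivl: "0 \<le> l \<Longrightarrow> r \<le> 1 \<Longrightarrow> {l..<r} \<in> sets haar_circle"
  by (auto simp: haar_circle_def sets_restrict_space_iff)

lemma measure_haar_circle_ivl:
  "\<lbrakk>0 \<le> l; l \<le> r; r \<le> 1\<rbrakk> \<Longrightarrow> measure haar_circle {l..<r} = r - l"
  unfolding haar_circle_def by (subst measure_restrict_space) auto

interpretation haar_circle: prob_space haar_circle
proof
  show "emeasure haar_circle (space haar_circle) = 1"
    unfolding haar_circle_def by (subst emeasure_restrict_space) auto
qed

text \<open>By completeness an almost-everywhere statement makes the exceptional set a null set, so
  the measurability of \<open>set_C\<close>, \<open>set_D\<close> and \<open>set_E\<close> follows
  without a separate proof.\<close>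

interpretation haar_circle: complete_measure haar_circle
proof
  fix A B :: "real set" assume "B \<subseteq> A" "A \<in> null_sets haar_circle"
  then show "B \<in> sets haar_circle"
    by (auto simp: haar_circle_def null_sets_restrict_space sets_restrict_space_iff
       intro: completion.complete)
qed

lemma height_to_circle:
  assumes "coprime a b" "b > 0"
  shows "height (to_circle (of_nat a / of_nat b)) = b"
proof -
  have "(of_nat a / of_nat b :: rat) = Fract (int a) (int b)" by (simp add: Fract_of_int_quotient)
  moreover have "coprime (int a) (int b)" using assms by simp
  ultimately have "quotient_of (of_nat a / of_nat b) = (int a, int b)"
    using assms by (simp add: quotient_of_Fract normalize_stable)
  then show ?thesis by (simp add: height.abs_eq)
qed

text \<open>\<open>farey k x = (a, b, a', b')\<close> encodes the Farey interval \<open>[a/b, a'/b')\<close> of order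
  \<open>k + 1\<close> containing \<open>x\<close>; accordingly \<open>farey_diff c k\<close> is
  \<open>S\<^bsub>k+2\<^esub> - S\<^bsub>k+1\<^esub>\<close>.\<close>

primrec farey :: "nat \<Rightarrow> real \<Rightarrow> nat \<times> nat \<times> nat \<times> nat" where
  "farey 0 x = (0, 1, 1, 1)"
| "farey (Suc k) x = (case farey k x of (a, b, a', b') \<Rightarrow>
     if b + b' = k + 2
     then if x < real (a + a') / real (b + b') then (a, b, a + a', b + b') else (a + a', b + b', a', b')
     else (a, b, a', b'))"

definition farey_diff :: "(rat_circle \<Rightarrow> real) \<Rightarrow> nat \<Rightarrow> real \<Rightarrow> real" where
  "farey_diff c k x = (case farey k x of (a, b, a', b') \<Rightarrow>
     if b + b' = k + 2
     then (if x < real (a + a') / real (b + b') then real b else - real b') *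
       c (to_circle (of_nat (a + a') / of_nat (b + b')))
     else 0)"

text \<open>The determinant 1 of the two endpoints is inherited by each endpoint paired with the
  mediant. This gives the gap lengths and the lowest terms.\<close>

lemma mediant_between:
  fixes a b a' b' :: nat
  assumes "a' * b = a * b' + 1" "b > 0" "b' > 0"
  shows "real (a + a') / real (b + b') - real a / real b = 1 / (real b * real (b + b'))"
    and "real a' / real b' - real (a + a') / real (b + b') = 1 / (real b' * real (b + b'))"
    and "real a / real b < real (a + a') / real (b + b')"
    and "real (a + a') / real (b + b') < real a' / real b'"
    and "coprime (a + a') (b + b')"
proof -
  have r: "real a' * real b = real a * real b' + 1" using assms(1) by (metis of_nat_1 of_nat_add of_nat_mult)
  have s: "real b > 0" "real b' > 0" using assms by auto
  show 1: "real (a + a') / real (b + b') - real a / real b = 1 / (real b * real (b + b'))"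
    and 2: "real a' / real b' - real (a + a') / real (b + b') = 1 / (real b' * real (b + b'))"
    using r s by (simp_all add: divide_simps) (simp_all add: algebra_simps)
  have "1 / (real b * real (b + b')) > 0" "1 / (real b' * real (b + b')) > 0" using s by auto
  then show "real a / real b < real (a + a') / real (b + b')"
    "real (a + a') / real (b + b') < real a' / real b'"
    using 1 2 by linarith+
  have "(a + a') * b = a * (b + b') + 1" using assms(1) by (simp add: algebra_simps)
  then show "coprime (a + a') (b + b')"
    by (metis coprimeI dvd_add_right_iff dvd_mult dvd_mult2 )
qed

lemma farey_Suc_cases:
  assumes "farey k x = (a, b, a', b')"
  obtains (same) "b + b' \<noteq> k + 2" "farey (Suc k) x = (a, b, a', b')"
  | (left) "b + b' = k + 2" "x < real (a + a') / real (b + b')" "farey (Suc k) x = (a, b, a + a', b + b')"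
  | (right) "b + b' = k + 2" "real (a + a') / real (b + b') \<le> x" "farey (Suc k) x = (a + a', b + b', a', b')"
proof -
  have "farey (Suc k) x = (if b + b' = k + 2
     then if x < real (a + a') / real (b + b') then (a, b, a + a', b + b') else (a + a', b + b', a', b')
     else (a, b, a', b'))"
    using assms by (simp only: farey.simps prod.case)
  then show thesis using that by (metis not_less)
qed

lemma farey_invariant:
  assumes "x \<in> {0..<1}" "farey k x = (a, b, a', b')"
  shows "a' * b = a * b' + 1 \<and> b > 0 \<and> b' > 0 \<and> a' \<le> b' \<and> real a / real b \<le> x \<and> x < real a' / real b'"
  using assms(2)
proof (induction k arbitrary: a b a' b')
  case 0
  then show ?case using assms(1) by auto
next
  case (Suc k)
  obtain a0 b0 a1 b1 where f: "farey k x = (a0, b0, a1, b1)" by (metis prod.exhaust)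
  note IH = Suc.IH[OF f]
  \<comment> \<open>When the mediant becomes the right endpoint, the bound of its numerator by its
    denominator needs the same bound for the left endpoint.\<close>
  have "real a0 / real b0 \<le> x" "x < 1" using IH assms(1) by auto
  then have "real a0 / real b0 < 1" by (rule le_less_trans)
  then have "a0 \<le> b0" using IH by (simp add: divide_less_eq)
  from f show ?case
  proof (cases rule: farey_Suc_cases)
    case left
    then have "a = a0" "b = b0" "a' = a0 + a1" "b' = b0 + b1" using Suc.prems by auto
    then show ?thesis using IH left(2) \<open>a0 \<le> b0\<close> by (simp add: algebra_simps)
  next
    case right
    then have "a = a0 + a1" "b = b0 + b1" "a' = a1" "b' = b1" using Suc.prems by auto
    then show ?thesis using IH right(2) by (simp add: algebra_simps)
  qed (use IH Suc.prems in auto)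
qed

text \<open>A point of the new interval lies in the parent interval, so by induction it has the same
  parent label, and then it falls on the same side of the mediant.\<close>

lemma farey_constant:
  assumes "x \<in> {0..<1}" "farey k x = (a, b, a', b')" "real a / real b \<le> y" "y < real a' / real b'"
  shows "farey k y = farey k x"
  using assms(2-)
proof (induction k arbitrary: a b a' b')
  case 0
  then show ?case by simp
next
  case (Suc k)
  obtain a0 b0 a1 b1 where f: "farey k x = (a0, b0, a1, b1)" by (metis prod.exhaust)
  have inv: "a1 * b0 = a0 * b1 + 1" "b0 > 0" "b1 > 0" using farey_invariant[OF assms(1) f] by auto
  note med = mediant_between(3,4)[OF inv]
  from f show ?case
  proof (cases rule: farey_Suc_cases)
    case same
    then have "farey k y = farey k x" using Suc.prems by (intro Suc.IH[OF f]) auto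
    then have "farey k y = (a0, b0, a1, b1)" using f by simp
    then show ?thesis by (cases rule: farey_Suc_cases) (use same in auto)
  next
    case left
    then have y: "real a0 / real b0 \<le> y" "y < real (a0 + a1) / real (b0 + b1)" using Suc.prems by auto
    then have "farey k y = (a0, b0, a1, b1)" using Suc.IH[OF f] med f by simp
    then show ?thesis by (cases rule: farey_Suc_cases) (use y left in auto)
  next
    case right
    then have y: "real (a0 + a1) / real (b0 + b1) \<le> y" "y < real a1 / real b1" using Suc.prems by auto
    then have "farey k y = (a0, b0, a1, b1)" using Suc.IH[OF f] med f by simp
    then show ?thesis by (cases rule: farey_Suc_cases) (use y right in auto)
  qed
qed

lemma farey_atom:
  assumes "x \<in> {0..<1}" "farey k x = (a, b, a', b')"
  shows "{y\<in>{0..<1}. farey k y = farey k x} = {real a / real b..<real a' / real b'}"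
proof -
  have "real a' / real b' \<le> 1" "real a / real b \<ge> 0" using farey_invariant[OF assms] by auto
  note lr = this
  show ?thesis
  proof (intro equalityI subsetI)
    fix y assume "y \<in> {y\<in>{0..<1}. farey k y = farey k x}"
    then have "y \<in> {0..<1}" "farey k y = (a, b, a', b')" using assms(2) by auto
    then show "y \<in> {real a / real b..<real a' / real b'}" using farey_invariant by simp
  next
    fix y assume y: "y \<in> {real a / real b..<real a' / real b'}"
    then have "farey k y = farey k x" using farey_constant[OF assms] by simp
    moreover have "0 \<le> y" "y < 1" using y lr unfolding atLeastLessThan_iff by linarith+
    ultimately show "y \<in> {y\<in>{0..<1}. farey k y = farey k x}" by simp
  qed
qed

lemma finite_farey: "finite (range (farey k))"
proof (induction k)
  case (Suc k)
  let ?l = "\<lambda>(a, b, a', b'). (a, b, a + a', b + b')" and ?r = "\<lambda>(a, b, a', b'). (a + a', b + b', a', b')"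
  have "range (farey (Suc k)) \<subseteq> range (farey k) \<union> ?l ` range (farey k) \<union> ?r ` range (farey k)"
  proof
    fix s assume "s \<in> range (farey (Suc k))"
    then obtain x where x: "s = farey (Suc k) x" by auto
    obtain a b a' b' where f: "farey k x = (a, b, a', b')" by (metis prod.exhaust)
    have "s = farey k x \<or> s = ?l (farey k x) \<or> s = ?r (farey k x)"
      by (cases rule: farey_Suc_cases[OF f]) (simp_all only: x f prod.case simp_thms)
    then show "s \<in> range (farey k) \<union> ?l ` range (farey k) \<union> ?r ` range (farey k)" by blast
  qed
  then show ?case using Suc by (meson finite_UnI finite_imageI finite_subset)
qed simp

text \<open>Refinement holds because each interval lies in its parent, and
  \<open>farey_constant\<close> turns membership in the parent interval into equality of
  labels.\<close>

interpretation farey: finite_filtration haar_circle farey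
proof
  fix k
  show "simple_function haar_circle (farey k)"
    unfolding simple_function_def
  proof (intro conjI ballI)
    show "finite (farey k ` space haar_circle)"
      using finite_farey[of k] by (rule finite_subset[rotated]) auto
    fix s assume "s \<in> farey k ` space haar_circle"
    then obtain x where x: "x \<in> {0..<1}" "s = farey k x" by auto
    obtain a b a' b' where f: "farey k x = (a, b, a', b')" by (metis prod.exhaust)
    have "farey k -` {s} \<inter> space haar_circle = {y\<in>{0..<1}. farey k y = farey k x}"
      unfolding x(2) space_haar_circle by blast
    also have "\<dots> = {real a / real b..<real a' / real b'}" using x(1) f by (rule farey_atom)
    also have "\<dots> \<in> sets haar_circle"
      using farey_invariant[OF x(1) f] by (intro sets_haar_circle_ivl) auto
    finally show "farey k -` {s} \<inter> space haar_circle \<in> sets haar_circle" .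
  qed
next
  fix x y k assume *: "x \<in> space haar_circle" "y \<in> space haar_circle" "farey (Suc k) x = farey (Suc k) y"
  then have x: "x \<in> {0..<1}" and y: "y \<in> {0..<1}" by auto
  obtain a0 b0 a1 b1 where f: "farey k x = (a0, b0, a1, b1)" by (metis prod.exhaust)
  have inv: "a1 * b0 = a0 * b1 + 1" "b0 > 0" "b1 > 0" using farey_invariant[OF x f] by auto
  note med = mediant_between(3,4)[OF inv]
  obtain a b a' b' where g: "farey (Suc k) x = (a, b, a', b')" by (metis prod.exhaust)
  have "farey (Suc k) y = (a, b, a', b')" using g * by simp
  then have "real a / real b \<le> y" "y < real a' / real b'" using farey_invariant[OF y] by blast+
  note yb = this
  from f have "real a0 / real b0 \<le> y \<and> y < real a1 / real b1"
  proof (cases rule: farey_Suc_cases)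
    case left
    then have "real a0 / real b0 \<le> y" "y < real (a0 + a1) / real (b0 + b1)" using yb g by auto
    then show ?thesis using med by linarith
  next
    case right
    then have "real (a0 + a1) / real (b0 + b1) \<le> y" "y < real a1 / real b1" using yb g by auto
    then show ?thesis using med by linarith
  qed (use yb g in auto)
  then show "farey k x = farey k y" using farey_constant[OF x f] by simp
qed

text \<open>After a split the label reveals the side of the mediant: the two child labels differ
  because the denominators are positive.\<close>

lemma farey_diff_adapted: "farey.adapted (Suc k) (farey_diff c k)"
proof (rule farey.adaptedI)
  fix x y assume *: "x \<in> space haar_circle" "y \<in> space haar_circle" "farey (Suc k) x = farey (Suc k) y"
  have "farey k x = farey k y" using * by (rule farey.atom_refine)
  obtain a b a' b' where f: "farey k x = (a, b, a', b')" by (metis prod.exhaust)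
  have b: "b' > 0" "b > 0" using farey_invariant[OF _ f] * by auto
  have g: "farey k y = (a, b, a', b')" using f \<open>farey k x = farey k y\<close> by simp
  have "x < real (a + a') / real (b + b') \<longleftrightarrow> y < real (a + a') / real (b + b')" if "b + b' = k + 2"
    using that b *(3) by (cases rule: farey_Suc_cases[OF f]; cases rule: farey_Suc_cases[OF g]) auto
  then show "farey_diff c k x = farey_diff c k y"
    unfolding farey_diff_def f g prod.case by simp
qed

lemma farey_diff_martingale:
  assumes K: "\<And>\<beta>. \<bar>c \<beta> * real (height \<beta>)\<bar> \<le> K"
  shows "farey.martingale_diff K (farey_diff c)"
proof (rule farey.martingale_diffI[OF farey_diff_adapted])
  fix k x assume "x \<in> space haar_circle"
  then have x: "x \<in> {0..<1}" by simp
  obtain a b a' b' where f: "farey k x = (a, b, a', b')" by (metis prod.exhaust)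
  have inv: "a' * b = a * b' + 1" "b > 0" "b' > 0" "a' \<le> b'" using farey_invariant[OF x f] by auto
  note med = mediant_between[OF inv(1-3)]
  define \<beta> where "\<beta> = to_circle (of_nat (a + a') / of_nat (b + b'))"
  define v where "v = real (a + a') / real (b + b')"
  have diff: "farey_diff c k y = (if b + b' = k + 2 then (if y < v then real b else - real b') * c \<beta> else 0)"
    if "farey k y = (a, b, a', b')" for y
    unfolding farey_diff_def v_def \<beta>_def that prod.case ..
  have h: "height \<beta> = b + b'" unfolding \<beta>_def using med(5) inv by (intro height_to_circle) auto
  have K0: "K \<ge> 0" using K[of \<beta>] by linarith
  \<comment> \<open>Each endpoint denominator is at most the height \<open>b + b'\<close> of the
    mediant, so the hypothesis on c bounds the increments.\<close>
  have "\<bar>c \<beta>\<bar> * real b \<le> \<bar>c \<beta>\<bar> * real (b + b')" "\<bar>c \<beta>\<bar> * real b' \<le> \<bar>c \<beta>\<bar> * real (b + b')"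
    by (intro mult_left_mono; simp)+
  moreover have "\<bar>c \<beta>\<bar> * real (b + b') \<le> K" using K[of \<beta>] h by (simp add: abs_mult)
  ultimately have "\<bar>c \<beta>\<bar> * real b \<le> K" "\<bar>c \<beta>\<bar> * real b' \<le> K" by linarith+
  then show "\<bar>farey_diff c k x\<bar> \<le> K"
    using K0 by (auto simp: diff[OF f] abs_mult mult.commute)
  let ?l = "real a / real b" and ?r = "real a' / real b'"
  have lr: "0 \<le> ?l" "?l < v" "v < ?r" "?r \<le> 1" using med(3,4) inv(3,4) unfolding v_def by auto
  have v: "0 \<le> v" "v \<le> 1" using lr by linarith+
  have atom: "{y\<in>space haar_circle. farey k y = farey k x} = {?l..<?r}"
    using farey_atom[OF x f] by simp
  show "(\<integral>y. farey_diff c k y * indicator {y\<in>space haar_circle. farey k y = farey k x} y \<partial>haar_circle) = 0"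
  proof (cases "b + b' = k + 2")
    case True
    have "farey_diff c k y * indicator {?l..<?r} y =
        c \<beta> * real b * indicator {?l..<v} y - c \<beta> * real b' * indicator {v..<?r} y" for y
    proof (cases "y \<in> {?l..<?r}")
      case y: True
      then have "farey k y = (a, b, a', b')" using farey_constant[OF x f] f by auto
      then have "farey_diff c k y = (if y < v then real b else - real b') * c \<beta>"
        using True diff by simp
      then show ?thesis using y by (auto simp: indicator_def)
    next
      case False
      then show ?thesis using lr by (auto simp: indicator_def)
    qed
    then have "(\<integral>y. farey_diff c k y * indicator {?l..<?r} y \<partial>haar_circle) =
        (\<integral>y. c \<beta> * real b * indicator {?l..<v} y - c \<beta> * real b' * indicator {v..<?r} y \<partial>haar_circle)"
      by presburger
    also have "\<dots> = c \<beta> * real b * measure haar_circle {?l..<v} - c \<beta> * real b' * measure haar_circle {v..<?r}"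
    proof -
      have s: "{?l..<v} \<in> sets haar_circle" "{v..<?r} \<in> sets haar_circle"
        using lr v by (auto intro!: sets_haar_circle_ivl simp del: divide_le_eq_1_pos)
      have i: "integrable haar_circle (indicator {?l..<v} :: real \<Rightarrow> real)"
        "integrable haar_circle (indicator {v..<?r} :: real \<Rightarrow> real)"
        using s by (auto intro!: integrable_real_indicator simp: haar_circle.emeasure_eq_measure)
      have m: "(\<integral>y. indicator {?l..<v} y \<partial>haar_circle) = measure haar_circle {?l..<v}"
        "(\<integral>y. indicator {v..<?r} y \<partial>haar_circle) = measure haar_circle {v..<?r}"
        using s by (simp_all only: Bochner_Integration.integral_indicator sets.Int_space_eq2)
      show ?thesis
        using i by (subst Bochner_Integration.integral_diff) (auto simp only: integral_mult_right_zero m intro!: integrable_mult_right)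
    qed
    also have "\<dots> = c \<beta> * real b * (v - ?l) - c \<beta> * real b' * (?r - v)"
      using lr v by (simp add: measure_haar_circle_ivl)
    \<comment> \<open>Both products of denominator and length equal \<open>1 / (b + b')\<close>, so
      the two pieces cancel.\<close>
    also have "\<dots> = 0" unfolding v_def med(1,2) using inv(2,3) by simp
    finally show ?thesis unfolding atom .
  next
    case False
    have "farey_diff c k y * indicator {?l..<?r} y = 0" for y
      using farey_constant[OF x f, of y] f False diff[of y] by (auto simp: indicator_def)
    then show ?thesis unfolding atom by (simp only: Bochner_Integration.integral_zero)
  qed
qed

subsection \<open>Farey intervals and continued fractions\<close>

lemma cf_tail_pos: "\<alpha> \<in> irrational_points \<Longrightarrow> cf_tail \<alpha> n > 0"
proof (cases n)
  case (Suc k)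
  assume "\<alpha> \<in> irrational_points"
  then have "cf_tail \<alpha> k \<notin> \<int>"
    using cf_tail_irrational[of \<alpha> k] Ints_subset_Rats by (auto simp: irrational_points_def)
  then show ?thesis by (simp add: Suc frac_gt_0_iff)
qed (simp add: irrational_points_def)

lemma cf_tail_split:
  assumes "\<alpha> \<in> irrational_points"
  shows "cf_tail \<alpha> n = real (cf_digit \<alpha> n) + 1 / cf_tail \<alpha> (Suc n)"
proof -
  have "real (cf_digit \<alpha> n) = of_int \<lfloor>cf_tail \<alpha> n\<rfloor>"
    unfolding cf_digit_def using cf_tail_pos[OF assms, of n] by simp
  then show ?thesis by (simp add: frac_def)
qed

lemma cf_digit_less_tail:
  assumes "\<alpha> \<in> irrational_points"
  shows "real (cf_digit \<alpha> n) < cf_tail \<alpha> n"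
proof -
  have "1 / cf_tail \<alpha> (Suc n) > 0" using cf_tail_pos[OF assms, of "Suc n"] by (rule divide_pos_pos[OF zero_less_one])
  then show ?thesis using cf_tail_split[OF assms, of n] by linarith
qed

text \<open>In the usual numbering: p_{n-1} q_{n-2} - p_{n-2} q_{n-1} = (-1)^n.\<close>

lemma cf_det:
  "real (cf_p \<alpha> (Suc n)) * real (cf_q \<alpha> n) - real (cf_p \<alpha> n) * real (cf_q \<alpha> (Suc n)) = (-1) ^ n"
proof (induction n)
  case (Suc n)
  have "real (cf_p \<alpha> (Suc (Suc n))) * real (cf_q \<alpha> (Suc n)) - real (cf_p \<alpha> (Suc n)) * real (cf_q \<alpha> (Suc (Suc n)))
     = - (real (cf_p \<alpha> (Suc n)) * real (cf_q \<alpha> n) - real (cf_p \<alpha> n) * real (cf_q \<alpha> (Suc n)))"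
    by (simp add: algebra_simps)
  then show ?case using Suc by simp
qed simp

text \<open>The classical \<alpha> = (t p_{n-1} + p_{n-2}) / (t q_{n-1} + q_{n-2}) with t the n-th
  complete quotient, cleared of denominators.\<close>

lemma cf_repr:
  assumes "\<alpha> \<in> irrational_points"
  shows "\<alpha> * (cf_tail \<alpha> n * real (cf_q \<alpha> (Suc n)) + real (cf_q \<alpha> n)) =
           cf_tail \<alpha> n * real (cf_p \<alpha> (Suc n)) + real (cf_p \<alpha> n)"
proof (induction n)
  case (Suc n)
  define t where "t = cf_tail \<alpha> (Suc n)"
  have t: "t > 0" unfolding t_def using cf_tail_pos[OF assms] .
  define s where "s = cf_tail \<alpha> n"
  have ts: "t * s = t * real (cf_digit \<alpha> n) + 1"
    unfolding s_def t_def cf_tail_split[OF assms, of n] using t[unfolded t_def]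
    by (simp add: distrib_left del: cf_tail.simps)
  have "\<alpha> * (t * real (cf_q \<alpha> (Suc (Suc n))) + real (cf_q \<alpha> (Suc n))) =
      \<alpha> * ((t * real (cf_digit \<alpha> n) + 1) * real (cf_q \<alpha> (Suc n)) + t * real (cf_q \<alpha> n))"
    by (simp add: algebra_simps)
  also have "\<dots> = t * (\<alpha> * (s * real (cf_q \<alpha> (Suc n)) + real (cf_q \<alpha> n)))"
    unfolding ts[symmetric] by (simp add: algebra_simps)
  also have "\<dots> = t * (s * real (cf_p \<alpha> (Suc n)) + real (cf_p \<alpha> n))"
    using Suc unfolding s_def by simp
  also have "\<dots> = (t * s) * real (cf_p \<alpha> (Suc n)) + t * real (cf_p \<alpha> n)"
    by (simp add: algebra_simps)
  also have "\<dots> = t * real (cf_p \<alpha> (Suc (Suc n))) + real (cf_p \<alpha> (Suc n))"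
    unfolding ts by (simp add: algebra_simps)
  finally show ?case unfolding t_def .
qed simp

text \<open>\<open>cf_frac \<alpha> n m\<close> is the \<open>m\<close>-th element of \<open>E\<^bsub>n\<^esub>\<close>.\<close>

definition cf_den :: "real \<Rightarrow> nat \<Rightarrow> nat \<Rightarrow> nat" where
  "cf_den \<alpha> n m = m * cf_q \<alpha> (Suc n) + cf_q \<alpha> n"

definition cf_num :: "real \<Rightarrow> nat \<Rightarrow> nat \<Rightarrow> nat" where
  "cf_num \<alpha> n m = m * cf_p \<alpha> (Suc n) + cf_p \<alpha> n"

definition cf_frac :: "real \<Rightarrow> nat \<Rightarrow> nat \<Rightarrow> rat_circle" where
  "cf_frac \<alpha> n m = to_circle (of_nat (cf_num \<alpha> n m) / of_nat (cf_den \<alpha> n m))"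

lemma cf_den_digit: "cf_den \<alpha> n (cf_digit \<alpha> n) = cf_q \<alpha> (Suc (Suc n))"
  by (simp add: cf_den_def)

lemma cf_den_Suc: "cf_den \<alpha> n (Suc m) = cf_q \<alpha> (Suc n) + cf_den \<alpha> n m"
  and cf_num_Suc: "cf_num \<alpha> n (Suc m) = cf_p \<alpha> (Suc n) + cf_num \<alpha> n m"
  by (simp_all add: cf_den_def cf_num_def)

lemma cf_q_Suc_pos:
  assumes "\<alpha> \<in> irrational_points" "n \<ge> 1"
  shows "cf_q \<alpha> (Suc n) > 0"
  using cf_q_pos[OF assms(1), of "n - 1"] assms(2) by (cases n) (simp_all add: numeral_2_eq_2 del: cf_q.simps)

lemma cf_den_pos: "\<lbrakk>\<alpha> \<in> irrational_points; n \<ge> 1; m \<ge> 1\<rbrakk> \<Longrightarrow> cf_den \<alpha> n m > 0"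
  using cf_q_Suc_pos by (auto simp: cf_den_def simp del: cf_q.simps)

lemma cf_q_mono:
  assumes "\<alpha> \<in> irrational_points" "i \<le> j"
  shows "cf_q \<alpha> (Suc i) \<le> cf_q \<alpha> (Suc j)"
proof (rule lift_Suc_mono_le[OF _ assms(2)])
  fix n
  show "cf_q \<alpha> (Suc n) \<le> cf_q \<alpha> (Suc (Suc n))"
  proof (cases n)
    case (Suc l)
    have "1 \<le> cf_digit \<alpha> n" using cf_digit_pos assms(1) Suc by (simp add: irrational_points_def)
    then have "1 * cf_q \<alpha> (Suc n) \<le> cf_digit \<alpha> n * cf_q \<alpha> (Suc n)" by (rule mult_le_mono1)
    then show ?thesis unfolding cf_q.simps(3)[of \<alpha> n] by linarith
  qed simp
qed

text \<open>The determinant of p_{n-1}/q_{n-1} and the m-th fraction is a unit, so any common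
  divisor of \<open>cf_num\<close> and \<open>cf_den\<close> is a unit.\<close>

lemma height_cf_frac:
  assumes "\<alpha> \<in> irrational_points" "n \<ge> 1" "m \<ge> 1"
  shows "height (cf_frac \<alpha> n m) = cf_den \<alpha> n m"
proof -
  have r: "real (cf_p \<alpha> (Suc n)) * real (cf_den \<alpha> n m) - real (cf_num \<alpha> n m) * real (cf_q \<alpha> (Suc n)) = (-1) ^ n"
    unfolding cf_den_def cf_num_def cf_det[of \<alpha> n, symmetric]
    by (simp add: algebra_simps del: cf_p.simps cf_q.simps)
  have "real_of_int (int (cf_p \<alpha> (Suc n)) * int (cf_den \<alpha> n m) - int (cf_num \<alpha> n m) * int (cf_q \<alpha> (Suc n))) = real_of_int ((-1) ^ n)"
    using r by (simp del: cf_p.simps cf_q.simps)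
  then have i: "int (cf_p \<alpha> (Suc n)) * int (cf_den \<alpha> n m) - int (cf_num \<alpha> n m) * int (cf_q \<alpha> (Suc n)) = (-1) ^ n"
    by (simp only: of_int_eq_iff)
  have "coprime (int (cf_num \<alpha> n m)) (int (cf_den \<alpha> n m))"
  proof (rule coprimeI)
    fix z assume "z dvd int (cf_num \<alpha> n m)" "z dvd int (cf_den \<alpha> n m)"
    then have "z dvd (-1) ^ n" unfolding i[symmetric] by (intro dvd_diff dvd_mult dvd_mult2)
    moreover have "is_unit ((-1 :: int) ^ n)" by (cases "even n") simp_all
    ultimately show "is_unit z" using dvd_trans by blast
  qed
  then show ?thesis unfolding cf_frac_def using cf_den_pos[OF assms] by (intro height_to_circle) auto
qed

text \<open>Both numbers are values of s -> (s p_{n-1} + p_{n-2}) / (s q_{n-1} + q_{n-2}): \<alpha>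
  at the complete quotient t, the fraction at m. Since m \<le> a_n < t, the sign of the determinant
  decides their order.\<close>

lemma cf_side:
  assumes "\<alpha> \<in> irrational_points" "n \<ge> 1" "1 \<le> m" "m \<le> cf_digit \<alpha> n"
  shows "\<alpha> < real (cf_num \<alpha> n m) / real (cf_den \<alpha> n m) \<longleftrightarrow> odd n"
proof -
  let ?t = "cf_tail \<alpha> n"
  define D where "D = ?t * real (cf_q \<alpha> (Suc n)) + real (cf_q \<alpha> n)"
  have D: "D > 0" unfolding D_def using cf_tail_pos[OF assms(1), of n] cf_q_Suc_pos[OF assms(1,2)]
    by (intro add_pos_nonneg mult_pos_pos) auto
  have aD: "\<alpha> * D = ?t * real (cf_p \<alpha> (Suc n)) + real (cf_p \<alpha> n)"
    unfolding D_def using cf_repr[OF assms(1)] .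
  have "D * (\<alpha> * real (cf_den \<alpha> n m) - real (cf_num \<alpha> n m)) = (\<alpha> * D) * real (cf_den \<alpha> n m) - real (cf_num \<alpha> n m) * D"
    by (simp add: algebra_simps)
  also have "\<dots> = (?t - real m) * (real (cf_p \<alpha> (Suc n)) * real (cf_q \<alpha> n) - real (cf_p \<alpha> n) * real (cf_q \<alpha> (Suc n)))"
    unfolding aD unfolding D_def cf_den_def cf_num_def by (simp add: algebra_simps del: cf_p.simps cf_q.simps)
  also have "\<dots> = (?t - real m) * (-1) ^ n" unfolding cf_det ..
  finally have e: "D * (\<alpha> * real (cf_den \<alpha> n m) - real (cf_num \<alpha> n m)) = (?t - real m) * (-1) ^ n" .
  have "real m \<le> real (cf_digit \<alpha> n)" using assms(4) by simp
  then have t: "?t - real m > 0" using cf_digit_less_tail[OF assms(1), of n] by linarith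
  have den: "real (cf_den \<alpha> n m) > 0" using cf_den_pos[OF assms(1-3)] by simp
  have "\<alpha> < real (cf_num \<alpha> n m) / real (cf_den \<alpha> n m) \<longleftrightarrow> \<alpha> * real (cf_den \<alpha> n m) - real (cf_num \<alpha> n m) < 0"
    using den by (simp add: less_divide_eq)
  also have "\<dots> \<longleftrightarrow> D * (\<alpha> * real (cf_den \<alpha> n m) - real (cf_num \<alpha> n m)) < 0"
    using D by (simp add: mult_less_0_iff)
  also have "\<dots> \<longleftrightarrow> odd n" unfolding e using t by (cases "even n") auto
  finally show ?thesis .
qed

section \<open>Cutoffs and sums over the blocks E_n\<close>

definition is_cutoff :: "real \<Rightarrow> nat \<Rightarrow> nat \<Rightarrow> nat \<Rightarrow> bool" where
  "is_cutoff \<alpha> Q M N \<longleftrightarrow> 1 \<le> N \<and> 1 \<le> M \<and> M \<le> cf_digit \<alpha> N \<and>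
     cf_den \<alpha> N M \<le> Q \<and> Q < cf_den \<alpha> N (Suc M)"

lemma cutoff_N_eq:
  assumes "\<alpha> \<in> irrational_points" "is_cutoff \<alpha> Q M N"
  shows "cutoff_N \<alpha> Q = N"
proof -
  have "Q \<ge> 1" using assms cf_den_pos[OF assms(1), of N M] by (auto simp: is_cutoff_def)
  have "cutoff \<alpha> Q = (M, N)"
    unfolding cutoff_def using cutoff_unique[OF assms(1) \<open>Q \<ge> 1\<close>] assms(2)
    by (intro the1_equality) (auto simp: is_cutoff_def cf_den_def simp del: cf_q.simps)
  then show ?thesis by (simp add: cutoff_N_def)
qed

text \<open>Distinct m give distinct heights, so the sum over the image set has no
  collisions.\<close>

lemma sum_cf_E:
  assumes "\<alpha> \<in> irrational_points" "n \<ge> 1"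
  shows "(\<Sum>\<beta>\<in>{\<beta> \<in> cf_E \<alpha> n. height \<beta> \<le> Q}. f \<beta>) =
           (\<Sum>m\<in>{m\<in>{1..cf_digit \<alpha> n}. cf_den \<alpha> n m \<le> Q}. f (cf_frac \<alpha> n m))"
proof -
  have E: "cf_E \<alpha> n = cf_frac \<alpha> n ` {1..cf_digit \<alpha> n}"
    unfolding cf_E_def cf_frac_def cf_num_def cf_den_def by simp
  have inj: "inj_on (cf_frac \<alpha> n) {1..cf_digit \<alpha> n}"
  proof (rule inj_onI)
    fix m m' assume "m \<in> {1..cf_digit \<alpha> n}" "m' \<in> {1..cf_digit \<alpha> n}" "cf_frac \<alpha> n m = cf_frac \<alpha> n m'"
    then have "cf_den \<alpha> n m = cf_den \<alpha> n m'"
      using height_cf_frac[OF assms, of m] height_cf_frac[OF assms, of m'] by simp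
    then show "m = m'" unfolding cf_den_def using cf_q_Suc_pos[OF assms] by simp
  qed
  let ?I = "{m\<in>{1..cf_digit \<alpha> n}. cf_den \<alpha> n m \<le> Q}"
  have "{\<beta> \<in> cf_E \<alpha> n. height \<beta> \<le> Q} = cf_frac \<alpha> n ` ?I"
    unfolding E using height_cf_frac[OF assms] by auto
  moreover have "inj_on (cf_frac \<alpha> n) ?I" using inj by (rule inj_on_subset) blast
  ultimately show ?thesis by (simp only: sum.reindex o_def)
qed

lemma sum_cf_E_all:
  assumes "\<alpha> \<in> irrational_points" "n \<ge> 1"
  shows "(\<Sum>\<beta>\<in>cf_E \<alpha> n. f \<beta>) = (\<Sum>m=1..cf_digit \<alpha> n. f (cf_frac \<alpha> n m))"
proof -
  define Q where "Q = cf_den \<alpha> n (cf_digit \<alpha> n)"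
  have Q: "cf_den \<alpha> n m \<le> Q" if "m \<in> {1..cf_digit \<alpha> n}" for m
    using that unfolding Q_def cf_den_def by simp
  have "{\<beta> \<in> cf_E \<alpha> n. height \<beta> \<le> Q} = cf_E \<alpha> n"
    unfolding cf_E_def using Q height_cf_frac[OF assms] by (auto simp: cf_frac_def cf_num_def cf_den_def)
  moreover have "{m\<in>{1..cf_digit \<alpha> n}. cf_den \<alpha> n m \<le> Q} = {1..cf_digit \<alpha> n}" using Q by auto
  ultimately show ?thesis using sum_cf_E[OF assms, where Q=Q and f=f] by simp
qed

text \<open>The weight and the summand are parameters so that one induction treats both
  \<open>S\<close> and its sum of squared increments.\<close>

definition truncated_sum :: "(nat \<Rightarrow> real) \<Rightarrow> (rat_circle \<Rightarrow> real) \<Rightarrow> real \<Rightarrow> nat \<Rightarrow> nat \<Rightarrow> real" where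
  "truncated_sum w f \<alpha> M N = (\<Sum>n=1..<N. w n * (\<Sum>m=1..cf_digit \<alpha> n. f (cf_frac \<alpha> n m))) +
     w N * (\<Sum>m=1..M. f (cf_frac \<alpha> N m))"

text \<open>For n < N the largest height in E_n is q_n \<le> q_{N-1} \<le> Q, so these blocks enter
  completely; in E_N the condition on the height means m \<le> M.\<close>

lemma S_eq_truncated_sum:
  assumes "\<alpha> \<in> irrational_points" "is_cutoff \<alpha> Q M N"
  shows "S c Q \<alpha> = truncated_sum (\<lambda>n. (-1) ^ (n - 1) * real (cf_q \<alpha> (Suc n))) c \<alpha> M N"
proof -
  have N: "1 \<le> N" "M \<le> cf_digit \<alpha> N" "cf_den \<alpha> N M \<le> Q" "Q < cf_den \<alpha> N (Suc M)"
    using assms(2) by (auto simp: is_cutoff_def)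
  have low: "{m\<in>{1..cf_digit \<alpha> n}. cf_den \<alpha> n m \<le> Q} = {1..cf_digit \<alpha> n}" if "n \<in> {1..<N}" for n
  proof -
    have "cf_den \<alpha> n m \<le> Q" if "m \<le> cf_digit \<alpha> n" for m
    proof -
      have "cf_den \<alpha> n m \<le> cf_den \<alpha> n (cf_digit \<alpha> n)" using that unfolding cf_den_def by simp
      also have "\<dots> = cf_q \<alpha> (Suc (Suc n))" by (rule cf_den_digit)
      also have "\<dots> \<le> cf_q \<alpha> (Suc N)" using \<open>n \<in> {1..<N}\<close> by (intro cf_q_mono assms(1)) simp
      also have "\<dots> \<le> 1 * cf_q \<alpha> (Suc N) + cf_q \<alpha> N" by simp
      also have "\<dots> \<le> cf_den \<alpha> N M" using assms(2) unfolding cf_den_def is_cutoff_def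
        by (intro add_mono mult_le_mono1) auto
      finally show ?thesis using N by linarith
    qed
    then show ?thesis by auto
  qed
  have top: "{m\<in>{1..cf_digit \<alpha> N}. cf_den \<alpha> N m \<le> Q} = {1..M}"
  proof -
    have "cf_den \<alpha> N m \<le> Q \<longleftrightarrow> m \<le> M" for m
    proof
      assume "m \<le> M"
      then have "cf_den \<alpha> N m \<le> cf_den \<alpha> N M" unfolding cf_den_def by simp
      then show "cf_den \<alpha> N m \<le> Q" using N by linarith
    next
      assume "cf_den \<alpha> N m \<le> Q"
      then have "cf_den \<alpha> N m < cf_den \<alpha> N (Suc M)" using N by linarith
      then have "m * cf_q \<alpha> (Suc N) < Suc M * cf_q \<alpha> (Suc N)" unfolding cf_den_def by linarith
      then have "m < Suc M" by (meson mult_less_cancel2)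
      then show "m \<le> M" by simp
    qed
    then have "{m\<in>{1..cf_digit \<alpha> N}. cf_den \<alpha> N m \<le> Q} = {m\<in>{1..cf_digit \<alpha> N}. m \<le> M}" by (simp only:)
    also have "\<dots> = {1..M}" using N(2) by auto
    finally show ?thesis .
  qed
  have inner: "(\<Sum>\<beta>\<in>{\<beta> \<in> cf_E \<alpha> n. height \<beta> \<le> Q}. c \<beta>) =
      (\<Sum>m=1..if n = N then M else cf_digit \<alpha> n. c (cf_frac \<alpha> n m))" if "n \<in> {1..N}" for n
  proof -
    have "n \<ge> 1" using that by simp
    note E = sum_cf_E[OF assms(1) this, where Q=Q and f=c]
    show ?thesis
    proof (cases "n = N")
      case True
      then show ?thesis using E top by (simp only: simp_thms if_True)
    next
      case False
      then have "n \<in> {1..<N}" using that by simp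
      then show ?thesis using E low False by (simp only: simp_thms if_False)
    qed
  qed
  have I: "{1..N} = insert N {1..<N}" using N by auto
  have "S c Q \<alpha> = (\<Sum>n=1..N. (-1) ^ (n - 1) * real (cf_q \<alpha> (Suc n)) *
      (\<Sum>m=1..if n = N then M else cf_digit \<alpha> n. c (cf_frac \<alpha> n m)))"
    unfolding S_def cutoff_N_eq[OF assms] Suc_eq_plus1[symmetric] using inner
    by (intro sum.cong refl arg_cong2[where f="(*)"])
  then show ?thesis unfolding I truncated_sum_def by simp
qed

lemma truncated_sum_Suc:
  "truncated_sum w f \<alpha> (Suc M) N = truncated_sum w f \<alpha> M N + w N * f (cf_frac \<alpha> N (Suc M))"
  by (simp add: truncated_sum_def algebra_simps)

lemma truncated_sum_next:
  assumes "1 \<le> N"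
  shows "truncated_sum w f \<alpha> 1 (Suc N) = truncated_sum w f \<alpha> (cf_digit \<alpha> N) N + w (Suc N) * f (cf_frac \<alpha> (Suc N) 1)"
  using assms by (simp add: truncated_sum_def)

text \<open>For the cutoff \<open>(M, N)\<close> of \<open>Q\<close>, the Farey neighbours of \<open>\<alpha>\<close> of order \<open>Q\<close> are
  \<open>p\<^bsub>N-1\<^esub>/q\<^bsub>N-1\<^esub>\<close> and the \<open>M\<close>-th element of \<open>E\<^bsub>N\<^esub>\<close>, on sides
  determined by the parity of \<open>N\<close>.\<close>

definition cf_state :: "real \<Rightarrow> nat \<Rightarrow> nat \<Rightarrow> nat \<times> nat \<times> nat \<times> nat" where
  "cf_state \<alpha> M N = (if odd N
     then (cf_p \<alpha> (Suc N), cf_q \<alpha> (Suc N), cf_num \<alpha> N M, cf_den \<alpha> N M)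
     else (cf_num \<alpha> N M, cf_den \<alpha> N M, cf_p \<alpha> (Suc N), cf_q \<alpha> (Suc N)))"

text \<open>From the state \<open>(a\<^sub>N, N)\<close> the next mediant belongs to \<open>E\<^bsub>N+1\<^esub>\<close>: the same pair of
  Farey neighbours is also the state \<open>(0, N + 1)\<close>.\<close>

lemma cf_state_digit: "cf_state \<alpha> (cf_digit \<alpha> N) N = cf_state \<alpha> 0 (Suc N)"
  by (simp add: cf_state_def cf_num_def cf_den_def)

text \<open>The mediant of p_{N-1}/q_{N-1} and the m-th fraction is the next fraction of the block.
  By \<open>cf_side\<close> the point lies between it and p_{N-1}/q_{N-1}; the kept endpoint
  supplies the weight. The value m = 0 serves the entry into a new block.\<close>

lemma farey_cf_step:
  assumes "\<alpha> \<in> irrational_points" "N \<ge> 1" "Suc m \<le> cf_digit \<alpha> N"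
    and f: "farey k \<alpha> = cf_state \<alpha> m N" and Q: "cf_den \<alpha> N (Suc m) = k + 2"
  shows "farey (Suc k) \<alpha> = cf_state \<alpha> (Suc m) N"
    and "farey_diff c k \<alpha> = (-1) ^ (N - 1) * real (cf_q \<alpha> (Suc N)) * c (cf_frac \<alpha> N (Suc m))"
proof -
  have side: "\<alpha> < real (cf_num \<alpha> N (Suc m)) / real (cf_den \<alpha> N (Suc m)) \<longleftrightarrow> odd N"
    using assms by (intro cf_side) auto
  have "farey (Suc k) \<alpha> = cf_state \<alpha> (Suc m) N \<and>
     farey_diff c k \<alpha> = (-1) ^ (N - 1) * real (cf_q \<alpha> (Suc N)) * c (cf_frac \<alpha> N (Suc m))"
  proof (cases "odd N")
    case True
    then have f: "farey k \<alpha> = (cf_p \<alpha> (Suc N), cf_q \<alpha> (Suc N), cf_num \<alpha> N m, cf_den \<alpha> N m)"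
      using f by (simp add: cf_state_def)
    then show ?thesis using True side unfolding farey.simps farey_diff_def cf_state_def f prod.case
        cf_num_Suc[symmetric] cf_den_Suc[symmetric] cf_frac_def
      by (simp only: Q simp_thms if_True if_False) simp
  next
    case False
    then have f: "farey k \<alpha> = (cf_num \<alpha> N m, cf_den \<alpha> N m, cf_p \<alpha> (Suc N), cf_q \<alpha> (Suc N))"
      using f by (simp add: cf_state_def)
    then show ?thesis using False side \<open>N \<ge> 1\<close> unfolding farey.simps farey_diff_def cf_state_def f prod.case
        add.commute[of "cf_num \<alpha> N m"] add.commute[of "cf_den \<alpha> N m"]
        cf_num_Suc[symmetric] cf_den_Suc[symmetric] cf_frac_def
      by (simp only: Q simp_thms if_True if_False) simp
  qed
  then show "farey (Suc k) \<alpha> = cf_state \<alpha> (Suc m) N"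
    "farey_diff c k \<alpha> = (-1) ^ (N - 1) * real (cf_q \<alpha> (Suc N)) * c (cf_frac \<alpha> N (Suc m))" by auto
qed

text \<open>Induction on the Farey order. The constant is the value at order 1: there the only
  fraction is 1/1, in E_1, with weight q_0 = 1.\<close>

lemma farey_cf:
  assumes \<alpha>: "\<alpha> \<in> irrational_points"
  shows "\<exists>M N. is_cutoff \<alpha> (Suc k) M N \<and> farey k \<alpha> = cf_state \<alpha> M N \<and>
     truncated_sum (\<lambda>n. (-1) ^ (n - 1) * real (cf_q \<alpha> (Suc n))) c \<alpha> M N =
       c (to_circle 1) + (\<Sum>j<k. farey_diff c j \<alpha>) \<and>
     truncated_sum (\<lambda>n. (real (cf_q \<alpha> (Suc n)))\<^sup>2) (\<lambda>\<beta>. (c \<beta>)\<^sup>2) \<alpha> M N =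
       (c (to_circle 1))\<^sup>2 + (\<Sum>j<k. (farey_diff c j \<alpha>)\<^sup>2)"
proof (induction k)
  case 0
  have d0: "cf_digit \<alpha> 0 = 0" using \<alpha> by (auto simp: cf_digit_def irrational_points_def floor_eq_iff)
  have "cf_digit \<alpha> 1 \<ge> 1" using \<alpha> cf_digit_pos by (simp add: irrational_points_def)
  then have "is_cutoff \<alpha> (Suc 0) 1 1" by (simp add: is_cutoff_def cf_den_def)
  moreover have "farey 0 \<alpha> = cf_state \<alpha> 1 1"
    by (simp add: cf_state_def cf_num_def cf_den_def d0)
  moreover have "cf_frac \<alpha> 1 1 = to_circle 1" by (simp add: cf_frac_def cf_num_def cf_den_def d0)
  ultimately show ?case
    by (intro exI[of _ 1]) (simp add: truncated_sum_def)
next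
  case (Suc k)
  let ?w = "\<lambda>n. (-1) ^ (n - 1) * real (cf_q \<alpha> (Suc n))" and ?v = "\<lambda>n. (real (cf_q \<alpha> (Suc n)))\<^sup>2"
  let ?f = "\<lambda>\<beta>. (c \<beta>)\<^sup>2"
  let ?G = "\<lambda>k M N. truncated_sum ?w c \<alpha> M N = c (to_circle 1) + (\<Sum>j<k. farey_diff c j \<alpha>) \<and>
     truncated_sum ?v ?f \<alpha> M N = (c (to_circle 1))\<^sup>2 + (\<Sum>j<k. (farey_diff c j \<alpha>)\<^sup>2)"
  obtain M N where IH: "is_cutoff \<alpha> (Suc k) M N" "farey k \<alpha> = cf_state \<alpha> M N" "?G k M N"
    using Suc by blast
  have MN: "1 \<le> N" "1 \<le> M" "M \<le> cf_digit \<alpha> N" "cf_den \<alpha> N M \<le> Suc k" "Suc k < cf_den \<alpha> N (Suc M)"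
    using IH(1) by (auto simp: is_cutoff_def)
  have sq: "(?w n * c \<beta>)\<^sup>2 = ?v n * ?f \<beta>" for n \<beta>
    by (simp add: power_mult_distrib power_even_eq[symmetric] flip: power_mult)
  show ?case
  proof (cases "cf_den \<alpha> N (Suc M) = k + 2")
    case False
    \<comment> \<open>The next mediant has denominator above k + 2, so the interval around \<alpha>
      is not split and nothing changes.\<close>
    then have 1: "is_cutoff \<alpha> (Suc (Suc k)) M N" using MN by (auto simp: is_cutoff_def)
    obtain a b a' b' where s: "farey k \<alpha> = (a, b, a', b')" "b + b' = cf_den \<alpha> N (Suc M)"
      using IH(2) by (auto simp: cf_state_def cf_den_Suc split: if_splits)
    then have "b + b' \<noteq> k + 2" using False by simp
    then have "farey (Suc k) \<alpha> = farey k \<alpha>" "farey_diff c k \<alpha> = 0"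
      using s(1) by (simp_all add: farey_diff_def)
    then show ?thesis using 1 IH by (intro exI[of _ M] exI[of _ N]) (simp del: farey.simps)
  next
    case Q: True
    show ?thesis
    proof (cases "M < cf_digit \<alpha> N")
      case True
      then have M': "Suc M \<le> cf_digit \<alpha> N" by simp
      note st = farey_cf_step[OF \<alpha> MN(1) M' IH(2) Q]
      have "cf_den \<alpha> N (Suc M) < cf_den \<alpha> N (Suc (Suc M))"
        using cf_q_Suc_pos[OF \<alpha> MN(1)] by (simp add: cf_den_Suc[of \<alpha> N "Suc M"])
      then have "is_cutoff \<alpha> (Suc (Suc k)) (Suc M) N" using MN M' Q by (auto simp: is_cutoff_def)
      moreover have "?G (Suc k) (Suc M) N"
        unfolding truncated_sum_Suc sum.lessThan_Suc st(2) sq using IH(3) by simp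
      ultimately show ?thesis using st(1) by blast
    next
      case False
      \<comment> \<open>E_N is exhausted. The next fraction is the first of E_{N+1}, of height q_N +
        q_{N-1}, and the interval is reread as the state (0, N + 1).\<close>
      then have M: "M = cf_digit \<alpha> N" using MN by simp
      have N': "Suc N \<ge> 1" by simp
      have d: "Suc 0 \<le> cf_digit \<alpha> (Suc N)" using cf_digit_pos \<alpha> by (simp add: irrational_points_def)
      have den: "cf_den \<alpha> (Suc N) (Suc 0) = cf_den \<alpha> N (Suc M)"
        unfolding M cf_den_Suc cf_den_digit by (simp add: cf_den_def)
      have st0: "farey k \<alpha> = cf_state \<alpha> 0 (Suc N)" using IH(2) cf_state_digit M by simp
      note st = farey_cf_step[OF \<alpha> N' d st0 den[unfolded Q]]
      have "cf_den \<alpha> (Suc N) (Suc 0) < cf_den \<alpha> (Suc N) (Suc (Suc 0))"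
        using cf_q_Suc_pos[OF \<alpha> N'] by (simp add: cf_den_Suc[of \<alpha> "Suc N" "Suc 0"])
      then have "is_cutoff \<alpha> (Suc (Suc k)) 1 (Suc N)" using d den Q by (auto simp: is_cutoff_def)
      moreover have "?G (Suc k) 1 (Suc N)"
        unfolding truncated_sum_next[OF MN(1)] sum.lessThan_Suc st(2) sq[of "Suc N"]
        using IH(3) M by (simp del: cf_q.simps power_Suc)
      ultimately show ?thesis using st(1) by (intro exI[of _ 1] exI[of _ "Suc N"]) (simp del: cf_q.simps farey.simps)
    qed
  qed
qed

lemma S_eq_farey:
  assumes "\<alpha> \<in> irrational_points"
  shows "S c (Suc k) \<alpha> = c (to_circle 1) + farey.psum (farey_diff c) k \<alpha>"
  using farey_cf[OF assms, of k c] S_eq_truncated_sum[OF assms] by (auto simp: farey.psum_def)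

text \<open>At the end of a block the two series have the same partial sum up to the constant from
  order 1. All terms are nonnegative, so each series bounds the partial sums of the other.\<close>

lemma set_E_iff_farey:
  assumes \<alpha>: "\<alpha> \<in> irrational_points"
  shows "\<alpha> \<in> set_E c \<longleftrightarrow> summable (\<lambda>k. (farey_diff c k \<alpha>)\<^sup>2)"
proof -
  let ?v = "\<lambda>n. (real (cf_q \<alpha> (Suc n)))\<^sup>2"
  let ?f = "\<lambda>\<beta>. (c \<beta>)\<^sup>2"
  define u where "u n = ?v n * (\<Sum>m=1..cf_digit \<alpha> n. ?f (cf_frac \<alpha> n m))" for n
  have u0: "u n \<ge> 0" for n unfolding u_def by (intro mult_nonneg_nonneg sum_nonneg) auto
  have "summable (\<lambda>n. (real (cf_q \<alpha> (n + 2)))\<^sup>2 * (\<Sum>\<beta> \<in> cf_E \<alpha> (n + 1). (c \<beta>)\<^sup>2)) \<longleftrightarrow> summable (\<lambda>n. u (Suc n))"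
    by (simp add: u_def sum_cf_E_all[OF \<alpha>] del: cf_q.simps)
  then have E: "\<alpha> \<in> set_E c \<longleftrightarrow> summable u" using \<alpha> by (simp add: set_E_def summable_Suc_iff)
  have T: "truncated_sum ?v ?f \<alpha> (cf_digit \<alpha> N) N = (\<Sum>n=1..N. u n)" if "1 \<le> N" for N
  proof -
    have "{1..N} = insert N {1..<N}" using that by auto
    then show ?thesis unfolding truncated_sum_def u_def by simp
  qed
  show ?thesis unfolding E
  proof
    assume s: "summable u"
    show "summable (\<lambda>k. (farey_diff c k \<alpha>)\<^sup>2)"
    proof (rule summableI_nonneg_bounded)
      fix k
      obtain M N where MN: "is_cutoff \<alpha> (Suc k) M N"
        "truncated_sum ?v ?f \<alpha> M N = (c (to_circle 1))\<^sup>2 + (\<Sum>j<k. (farey_diff c j \<alpha>)\<^sup>2)"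
        using farey_cf[OF \<alpha>, of k c] by blast
      have "(\<Sum>j<k. (farey_diff c j \<alpha>)\<^sup>2) \<le> truncated_sum ?v ?f \<alpha> M N" using MN by simp
      \<comment> \<open>Completing the block N only adds nonnegative terms.\<close>
      also have "\<dots> \<le> truncated_sum ?v ?f \<alpha> (cf_digit \<alpha> N) N"
        unfolding truncated_sum_def using MN(1)
        by (intro add_mono mult_left_mono sum_mono2) (auto simp: is_cutoff_def)
      also have "\<dots> = (\<Sum>n=1..N. u n)" using MN(1) by (intro T) (auto simp: is_cutoff_def)
      also have "\<dots> \<le> suminf u" using s u0 by (intro sum_le_suminf) auto
      finally show "(\<Sum>j<k. (farey_diff c j \<alpha>)\<^sup>2) \<le> suminf u" .
    qed simp
  next
    assume s: "summable (\<lambda>k. (farey_diff c k \<alpha>)\<^sup>2)"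
    let ?B = "(c (to_circle 1))\<^sup>2 + (\<Sum>k. (farey_diff c k \<alpha>)\<^sup>2)"
    have "summable (\<lambda>n. u (Suc n))"
    proof (rule summableI_nonneg_bounded[of _ ?B])
      fix n
      define N where "N = Suc n"
      have d: "1 \<le> cf_digit \<alpha> N" using cf_digit_pos \<alpha> by (simp add: irrational_points_def N_def)
      have N: "1 \<le> N" by (simp add: N_def)
      \<comment> \<open>The order k + 1 is the height q_N of the last fraction of E_N; its cutoff is
        (a_N, N), hence by uniqueness the pair delivered by \<open>farey_cf\<close>.\<close>
      define k where "k = cf_den \<alpha> N (cf_digit \<alpha> N) - 1"
      have k: "Suc k = cf_den \<alpha> N (cf_digit \<alpha> N)" using cf_den_pos[OF \<alpha> N d] by (simp add: k_def)
      have "is_cutoff \<alpha> (Suc k) (cf_digit \<alpha> N) N"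
        using d N cf_q_Suc_pos[OF \<alpha> N] unfolding is_cutoff_def k cf_den_Suc by simp
      moreover obtain M' N' where MN: "is_cutoff \<alpha> (Suc k) M' N'"
        "truncated_sum ?v ?f \<alpha> M' N' = (c (to_circle 1))\<^sup>2 + (\<Sum>j<k. (farey_diff c j \<alpha>)\<^sup>2)"
        using farey_cf[OF \<alpha>, of k c] by blast
      ultimately have "M' = cf_digit \<alpha> N \<and> N' = N"
        using cutoff_unique[OF \<alpha>, of "Suc k"] unfolding is_cutoff_def cf_den_def by auto
      then have "(\<Sum>n=1..N. u n) = (c (to_circle 1))\<^sup>2 + (\<Sum>j<k. (farey_diff c j \<alpha>)\<^sup>2)"
        using MN(2) T[OF N] by simp
      also have "\<dots> \<le> ?B" using s by (intro add_left_mono sum_le_suminf) auto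
      finally have "(\<Sum>n=1..N. u n) \<le> ?B" .
      moreover have "(\<Sum>i<n. u (Suc i)) \<le> (\<Sum>n=1..N. u n)"
      proof -
        have "(\<Sum>i<n. u (Suc i)) = sum u (Suc ` {..<n})" by (simp add: sum.reindex)
        also have "\<dots> \<le> (\<Sum>n=1..N. u n)" using u0 by (intro sum_mono2) (auto simp: N_def)
        finally show ?thesis .
      qed
      ultimately show "(\<Sum>i<n. u (Suc i)) \<le> ?B" by linarith
    qed (use u0 in simp)
    then show "summable u" by (simp add: summable_Suc_iff)
  qed
qed

subsection \<open>The theorem\<close>

lemma AE_irrational_points: "AE x in haar_circle. x \<in> irrational_points"
proof -
  have "countable (\<rat> \<inter> {0..<1} :: real set)" by (simp add: countable_rat)
  then have "\<rat> \<inter> {0..<1 :: real} \<in> null_sets lebesgue"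
    by (intro null_sets_completionI countable_imp_null_set_lborel)
  then have "\<rat> \<inter> {0..<1} \<in> null_sets haar_circle"
    unfolding haar_circle_def by (subst null_sets_restrict_space) auto
  then have "AE x in haar_circle. x \<notin> \<rat> \<inter> {0..<1}" by (rule AE_not_in)
  then show ?thesis using AE_space
  proof eventually_elim
    case (elim x)
    then have "x \<noteq> 0" by auto
    then show ?case using elim by (auto simp: irrational_points_def)
  qed
qed

lemma limsup_eq_PInf:
  fixes u :: "nat \<Rightarrow> real"
  assumes "\<And>L. \<exists>k. u k > L"
  shows "limsup (\<lambda>k. ereal (u k)) = \<infinity>"
proof (rule ccontr)
  assume "limsup (\<lambda>k. ereal (u k)) \<noteq> \<infinity>"
  then have "limsup (\<lambda>k. ereal (u k)) < \<infinity>" by (simp add: less_top[symmetric] top_ereal_def)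
  then obtain y where "limsup (\<lambda>k. ereal (u k)) < ereal y" using ereal_dense2 by blast
  then have "eventually (\<lambda>k. ereal (u k) < ereal y) sequentially" by (rule Limsup_lessD)
  then obtain n where n: "\<And>k. k \<ge> n \<Longrightarrow> u k < y" by (auto simp: eventually_sequentially)
  \<comment> \<open>Exceeding the first n terms as well as y forces k \<ge> n, so a single large
    term suffices.\<close>
  obtain k where k: "u k > Max (insert y (u ` {..<n}))" using assms by blast
  then have "u k > y" "u k \<notin> u ` {..<n}" by (auto simp: Max_less_iff)
  then show False using n[of k] by (cases "k < n") auto
qed

lemma liminf_eq_MInf:
  fixes u :: "nat \<Rightarrow> real"
  assumes "\<And>L. \<exists>k. u k < L"
  shows "liminf (\<lambda>k. ereal (u k)) = -\<infinity>"
proof -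
  have "\<exists>k. - u k > L" for L using assms[of "- L"] by (simp add: less_minus_iff)
  then have "limsup (\<lambda>k. ereal (- u k)) = \<infinity>" by (rule limsup_eq_PInf)
  then have "- liminf (\<lambda>k. ereal (u k)) = \<infinity>"
    using ereal_Limsup_uminus[of sequentially "\<lambda>k. ereal (u k)"] by simp
  then show ?thesis by (metis ereal_uminus_uminus)
qed

theorem theorem3:
  fixes c :: "rat_circle \<Rightarrow> real"
  assumes "bounded (range (\<lambda>\<beta>. c \<beta> * real (height \<beta>)))"
  shows "emeasure haar_circle (set_C c \<union> set_D c) = 1 \<and>
         set_C c - set_E c \<in> null_sets haar_circle \<and>
         set_E c - set_C c \<in> null_sets haar_circle"
proof -
  obtain K where "\<And>\<beta>. \<bar>c \<beta> * real (height \<beta>)\<bar> \<le> K"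
    using assms by (auto simp: bounded_iff)
  then have mart: "farey.martingale_diff K (farey_diff c)" by (rule farey_diff_martingale)
  let ?X = "farey.psum (farey_diff c)" and ?s = "c (to_circle 1)"
  have conv: "\<alpha> \<in> set_C c \<longleftrightarrow> convergent (\<lambda>k. ?X k \<alpha>)" if \<alpha>: "\<alpha> \<in> irrational_points" for \<alpha>
  proof -
    \<comment> \<open>The shift removes Q = 0, where no cutoff exists and \<open>S\<close> has an
      unspecified value.\<close>
    have "convergent (\<lambda>Q. S c Q \<alpha>) \<longleftrightarrow> convergent (\<lambda>k. S c (Suc k) \<alpha>)"
      by (rule convergent_Suc_iff[of "\<lambda>Q. S c Q \<alpha>", symmetric])
    also have "\<dots> \<longleftrightarrow> convergent (\<lambda>k. ?X k \<alpha>)"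
      unfolding S_eq_farey[OF \<alpha>] by (rule convergent_add_const_iff)
    finally show ?thesis using \<alpha> by (simp add: set_C_def)
  qed
  have div: "\<alpha> \<in> set_D c" if \<alpha>: "\<alpha> \<in> irrational_points"
    and nb: "\<nexists>L. \<forall>k. ?X k \<alpha> \<le> L" "\<nexists>L. \<forall>k. ?X k \<alpha> \<ge> L" for \<alpha>
  proof -
    have "\<exists>k. S c k \<alpha> > L" "\<exists>k. S c k \<alpha> < L" for L
    proof -
      obtain k where "?X k \<alpha> > L - ?s" using nb(1) not_le by blast
      then show "\<exists>k. S c k \<alpha> > L" by (intro exI[of _ "Suc k"]) (simp add: S_eq_farey[OF \<alpha>])
      obtain k where "?X k \<alpha> < L - ?s" using nb(2) not_le by blast
      then show "\<exists>k. S c k \<alpha> < L" by (intro exI[of _ "Suc k"]) (simp add: S_eq_farey[OF \<alpha>])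
    qed
    then show ?thesis using \<alpha> by (simp add: set_D_def limsup_eq_PInf liminf_eq_MInf)
  qed
  have bdd: "\<exists>L. \<forall>k. \<bar>?X k \<alpha>\<bar> \<le> L" if "convergent (\<lambda>k. ?X k \<alpha>)" for \<alpha>
    using convergent_imp_Bseq[OF that] by (auto simp: Bseq_def)
  have all: "AE x in haar_circle. x \<in> set_C c \<union> set_D c \<and> x \<notin> set_C c - set_E c \<and> x \<notin> set_E c - set_C c"
    using AE_irrational_points farey.AE_convergent_of_summable[OF mart]
      farey.AE_summable_of_bounded[OF mart] farey.AE_bounded_of_one_sided[OF mart]
  proof eventually_elim
    case (elim x)
    \<comment> \<open>Either the partial sums are unbounded on both sides, which gives
      \<open>set_D\<close>, or they are bounded, hence square summable, hence convergent.\<close>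
    show ?case
      using elim bdd[of x] conv[of x] div[of x] set_E_iff_farey[of x c] by blast
  qed
  have sub: "set_C c \<subseteq> {0..<1}" "set_D c \<subseteq> {0..<1}" "set_E c \<subseteq> {0..<1}"
    by (auto simp: set_C_def set_D_def set_E_def irrational_points_def)
  have "set_C c - set_E c \<in> null_sets haar_circle" "set_E c - set_C c \<in> null_sets haar_circle"
    using all sub by (auto simp: haar_circle.null_sets_iff_AE elim: eventually_mono)
  moreover have "emeasure haar_circle (set_C c \<union> set_D c) = 1"
  proof -
    have null: "{0..<1} - (set_C c \<union> set_D c) \<in> null_sets haar_circle"
      using all by (auto simp: haar_circle.null_sets_iff_AE elim: eventually_mono)
    have "set_C c \<union> set_D c = space haar_circle - ({0..<1} - (set_C c \<union> set_D c))"
      using sub by auto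
    then have "emeasure haar_circle (set_C c \<union> set_D c) = emeasure haar_circle (space haar_circle)"
      using emeasure_Diff_null_set[OF null sets.top] by simp
    then show ?thesis by (simp only: haar_circle.emeasure_space_1)
  qed
  ultimately show ?thesis by blast
qed

end
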